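(* \begin{enumerate} \item For every $n\ge 4$, $\mathrm{ex}_b(n,S_{3,1,1})\le 3n$, with equality if and only if $n$ is a multiple of $3$. If $n$ is a multiple of $3$, the unique extremal graph (up to isomorphism) is $\frac n3K_{3,3}$. \item $\mathrm{ex}_b(n,D_{2,2})=4n-8$ for every $n\ge 5$, and the unique extremal graph (up to isomorphism) is $2K_{2,n-2}$ if $n\ge 6$. Moreover, $\mathrm{ex}_b(3,D_{2,2})=6$ and $\mathrm{ex}_b(4,D_{2,2})=9$. \item $\mathrm{ex}_b(n,S_{2,2,1})=4n-8$ for every $n\ge 4$, and $\mathrm{ex}_b(3,S_{2,2,1})=6$. \end{enumerate}
   Context: All graphs are finite and simple. A graph is $F$-free if it has no (not necessarily induced) subgraph isomorphic to $F$. $\mathrm{ex}_b(n,F)$ is the largest number of edges of an $F$-free bipartite graph with both parts of size $n$; an extremal graph is such a graph attaining the maximum. The spider $S_{a_1,\dots,a_j}$ is obtained from $j$ paths with $a_1,\dots,a_j$ edges by identifying one endpoint of all the paths. The double star $D_{a,b}$ is the tree on $a+b+2$ vertices consisting of an edge $uv$ together with $a$ leaves attached to $u$ and $b$ leaves attached to $v$. $kH$ denotes the vertex-disjoint union of $k$ copies of $H$. (In $2K_{2,n-2}$, viewed inside $K_{n,n}$, the two copies have their parts of size 2 on opposite sides.) *)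

theory Defs
  imports Main
begin

record 'a graph =
  verts :: "'a set"
  edges :: "'a set set"

definition simple_graph :: "'a graph \<Rightarrow> bool" where
  "simple_graph G \<longleftrightarrow> finite (verts G) \<and> (\<forall>e \<in> edges G. e \<subseteq> verts G \<and> card e = 2)"

definition subgraph :: "'a graph \<Rightarrow> 'a graph \<Rightarrow> bool" where
  "subgraph H G \<longleftrightarrow> simple_graph H \<and> verts H \<subseteq> verts G \<and> edges H \<subseteq> edges G"

definition graph_iso :: "'a graph \<Rightarrow> 'b graph \<Rightarrow> bool" (infix "\<cong>\<^sub>G" 50) where
  "G \<cong>\<^sub>G H \<longleftrightarrow> (\<exists>f. bij_betw f (verts G) (verts H) \<and> edges H = (`) f ` edges G)"

definition graph_free :: "'b graph \<Rightarrow> 'a graph \<Rightarrow> bool" where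
  "graph_free F G \<longleftrightarrow> \<not> (\<exists>H. subgraph H G \<and> H \<cong>\<^sub>G F)"

definition balanced_bipartite :: "nat \<Rightarrow> 'a graph \<Rightarrow> bool" where
  "balanced_bipartite n G \<longleftrightarrow> simple_graph G \<and>
     (\<exists>A B. A \<union> B = verts G \<and> A \<inter> B = {} \<and> card A = n \<and> card B = n \<and>
        (\<forall>e \<in> edges G. \<exists>a \<in> A. \<exists>b \<in> B. e = {a, b}))"

text \<open>A finite graph is isomorphic to one whose vertices are natural numbers, so it is no loss
  that the maximum ranges over graphs on that type. The maximum is over a finite set, and this set
  is nonempty if F has an edge, since then the edgeless graph is F-free.\<close>

definition ex_b :: "nat \<Rightarrow> 'b graph \<Rightarrow> nat" where
  "ex_b n F = Max {card (edges G) | G :: nat graph. balanced_bipartite n G \<and> graph_free F G}"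

lemma finite_ex_b:
  "finite {card (edges G) | G :: nat graph. balanced_bipartite n G \<and> graph_free F G}"
proof -
  have "card (edges G) \<le> 2 ^ (2 * n)" if bip: "balanced_bipartite n G" for G :: "nat graph"
  proof -
    have fin: "finite (verts G)" and sub: "edges G \<subseteq> Pow (verts G)"
      using bip by (auto simp: balanced_bipartite_def simple_graph_def)
    obtain A B where "A \<union> B = verts G" "A \<inter> B = {}" "card A = n" "card B = n"
      using bip by (auto simp: balanced_bipartite_def)
    then have "card (verts G) = 2 * n"
      using fin by (metis card_Un_disjoint finite_Un mult_2)
    then show ?thesis
      using card_mono[OF _ sub] fin by (simp add: card_Pow)
  qed
  then have "{card (edges G) | G :: nat graph. balanced_bipartite n G \<and> graph_free F G}
    \<subseteq> {.. 2 ^ (2 * n)}"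
    by auto
  then show ?thesis
    by (rule finite_subset) simp
qed

definition extremal_b :: "nat \<Rightarrow> 'b graph \<Rightarrow> 'a graph \<Rightarrow> bool" where
  "extremal_b n F G \<longleftrightarrow>
     balanced_bipartite n G \<and> graph_free F G \<and> card (edges G) = ex_b n F"

text \<open>Leg number i of the spider is the path on the vertices (i, 0), ..., (i, l) where l is the
  i-th entry of the list; the vertices (i, 0) are all identified with (0, 0).\<close>

definition leg_vertex :: "nat \<Rightarrow> nat \<Rightarrow> nat \<times> nat" where
  "leg_vertex i j = (if j = 0 then (0, 0) else (i, j))"

definition spider :: "nat list \<Rightarrow> (nat \<times> nat) graph" where
  "spider ls = \<lparr>
     verts = {leg_vertex i j | i j. i < length ls \<and> j \<le> ls ! i},
     edges = {{leg_vertex i j, leg_vertex i (Suc j)} | i j. i < length ls \<and> j < ls ! i}\<rparr>"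

text \<open>The centres u and v are (False, 0) and (True, 0); their leaves are the other vertices with
  the same first component.\<close>

definition double_star :: "nat \<Rightarrow> nat \<Rightarrow> (bool \<times> nat) graph" where
  "double_star a b = \<lparr>
     verts = {False} \<times> {0..a} \<union> {True} \<times> {0..b},
     edges = {{(False, 0), (True, 0)}}
       \<union> {{(False, 0), (False, i)} | i. i \<in> {1..a}}
       \<union> {{(True, 0), (True, i)} | i. i \<in> {1..b}}\<rparr>"

definition complete_bipartite :: "nat \<Rightarrow> nat \<Rightarrow> (nat + nat) graph" where
  "complete_bipartite s t = \<lparr>
     verts = {..<s} <+> {..<t},
     edges = {{Inl i, Inr j} | i j. i < s \<and> j < t}\<rparr>"

definition copies :: "nat \<Rightarrow> 'a graph \<Rightarrow> (nat \<times> 'a) graph" where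
  "copies k H = \<lparr>
     verts = {..<k} \<times> verts H,
     edges = {Pair i ` e | i e. i < k \<and> e \<in> edges H}\<rparr>"

end

theory Submission
  imports Defs
begin

text \<open>The number of edges is bounded by counting degrees.

  In a graph without $S_{3,1,1}$, deleting a vertex of degree at most 1 costs at most one edge; once
  all degrees are at least 2, a vertex of degree 4 would be the centre of an $S_{3,1,1}$, so all
  degrees are at most 3. Hence $2e \<le> 3|V|$, equality forces 3-regularity, and then any two vertices
  with a common neighbour have the same neighbourhood.

  Call a vertex high if its degree is at least 3, and let $s$ and $t$ be the numbers of high vertices
  on the two sides. In a graph without $D_{2,2}$ no two high vertices are adjacent, so
  $e \<le> 2(n-s) + 2(n-t)$ and $e \<le> s(n-t) + 2(n-s)$, and symmetrically. For $n \<ge> 6$ the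
  value $4n-8$ is reached only with $s = t = 2$, where all counts are tight.

  In a graph without $S_{2,2,1}$ an edge between two high vertices forces all their other neighbours
  to be leaves, and these leaves compensate for the edge, so $e \<le> 2(n-s) + 2(n-t)$ still holds. The
  small cases $(s,t) = (1,1), (2,1), (1,2)$ are counted separately.\<close>

section \<open>Embeddings and the extremal number\<close>

text \<open>In a bipartite host, tree vertices at odd distance never collide, so an embedding only
  has to be checked for coincidences within one side; this is why degree conditions alone produce
  the forbidden trees.

  The deletion argument for the spider with legs 3, 1, 1 destroys the balance of the sides, so its
  bound is proved for arbitrary sides in terms of |A| + |B|. A deleted vertex lowers 3|V| by 3 but
  2e by at most 2; hence a graph with equality has minimum degree at least 2 from the start.

  The threshold 3 is the degree of each centre of the double star and of the centre of the spider
  with legs 2, 2, 1. For the double star the rival of s = t = 2 is s = t = 1, which allows 3n - 3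
  edges: this is the optimum 9 at n = 4, ties with 4n - 8 at n = 5 and loses from n = 6 on. For the
  spider with legs 2, 2, 1 the general bound gives only 4n - 4 for s = t = 1 and 4n - 6 for s + t =
  3, hence the separate counts.\<close>

definition embeds :: "'b graph \<Rightarrow> 'a graph \<Rightarrow> bool" where
  "embeds F G \<longleftrightarrow>
    (\<exists>f. inj_on f (verts F) \<and> f ` verts F \<subseteq> verts G \<and> (\<forall>e \<in> edges F. f ` e \<in> edges G))"

text \<open>Invert the isomorphism in one direction, take the image of the map in the other.
  Simplicity of F makes that image a simple graph, as \<open>subgraph\<close> demands, and keeps
  edges within the set on which the map is inverted.\<close>

lemma graph_free_iff_no_embedding:
  assumes F: "simple_graph F"
  shows "graph_free F G \<longleftrightarrow> \<not> embeds F G"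
proof -
  have "embeds F G" if H: "subgraph H G" and iso: "H \<cong>\<^sub>G F" for H
  proof -
    obtain f where f: "bij_betw f (verts H) (verts F)" "edges F = (`) f ` edges H"
      using iso by (auto simp: graph_iso_def)
    define g where "g = inv_into (verts H) f"
    have g: "bij_betw g (verts F) (verts H)"
      unfolding g_def using f(1) by (rule bij_betw_inv_into)
    have "g ` e \<in> edges G" if "e \<in> edges F" for e
    proof -
      obtain e' where e': "e = f ` e'" "e' \<in> edges H" using \<open>e \<in> edges F\<close> f(2) by auto
      then have "e' \<subseteq> verts H" using H by (auto simp: subgraph_def simple_graph_def)
      then have "g ` e = e'"
        using e'(1) f(1) inv_into_image_cancel[of f "verts H" e'] by (simp add: g_def bij_betw_def)
      then show ?thesis using e'(2) H by (auto simp: subgraph_def)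
    qed
    moreover have "g ` verts F \<subseteq> verts G"
      using g H by (auto simp: subgraph_def bij_betw_def)
    ultimately show ?thesis using g unfolding bij_betw_def embeds_def by blast
  qed
  moreover have "\<exists>H. subgraph H G \<and> H \<cong>\<^sub>G F"
    if "embeds F G"
  proof -
    obtain f where f: "inj_on f (verts F)" "f ` verts F \<subseteq> verts G"
      "\<forall>e \<in> edges F. f ` e \<in> edges G"
      using \<open>embeds F G\<close> unfolding embeds_def by blast
    define H where "H = \<lparr>verts = f ` verts F, edges = (`) f ` edges F\<rparr>"
    define g where "g = inv_into (verts F) f"
    have e: "e \<subseteq> verts F" "card e = 2" if "e \<in> edges F" for e
      using that F by (auto simp: simple_graph_def)
    have "card (f ` e) = 2" if "e \<in> edges F" for e
      using e[OF that] f(1) by (metis card_image inj_on_subset)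
    then have "subgraph H G"
      using f F e unfolding subgraph_def simple_graph_def H_def by fastforce
    moreover have "bij_betw g (verts H) (verts F)"
      unfolding g_def H_def using f(1) by (simp add: bij_betw_inv_into inj_on_imp_bij_betw)
    moreover have "g ` (f ` e) = e" if "e \<in> edges F" for e
      unfolding g_def using f(1) e(1)[OF that] by (rule inv_into_image_cancel)
    then have "edges F = (`) g ` edges H"
      unfolding H_def by (force simp: image_image)
    ultimately show ?thesis unfolding graph_iso_def by blast
  qed
  ultimately show ?thesis unfolding graph_free_def by metis
qed

text \<open>The extremal graphs live on pairs and sums, whereas \<open>ex_b\<close> ranges over
  graphs on natural numbers. An injective renumbering preserves balance, freeness and edge count; an
  embedding into the copy is pulled back by the inverse.\<close>

lemma ex_nat_copy:
  fixes G :: "'a graph"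
  assumes G: "balanced_bipartite n G" and free: "graph_free F G" and F: "simple_graph F"
  shows "\<exists>G' :: nat graph. balanced_bipartite n G' \<and> graph_free F G' \<and>
    card (edges G') = card (edges G)"
proof -
  have simple: "simple_graph G" using G by (simp add: balanced_bipartite_def)
  then have fin: "finite (verts G)" and sub: "e \<subseteq> verts G" and two: "card e = 2"
    if "e \<in> edges G" for e
    using that by (auto simp: simple_graph_def)
  have fin: "finite (verts G)" using simple by (simp add: simple_graph_def)
  obtain f :: "'a \<Rightarrow> nat" where f: "inj_on f (verts G)"
    using fin finite_imp_inj_to_nat_seg by blast
  define g where "g = inv_into (verts G) f"
  define G' where "G' = \<lparr>verts = f ` verts G, edges = (`) f ` edges G\<rparr>"
  have gf: "g ` (f ` e) = e" if "e \<in> edges G" for e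
    unfolding g_def using f sub[OF that] by (rule inv_into_image_cancel)
  have "card (f ` e) = 2" if "e \<in> edges G" for e
    using sub[OF that] two[OF that] f by (metis card_image inj_on_subset)
  then have simple': "simple_graph G'"
    using fin sub unfolding simple_graph_def G'_def by fastforce
  obtain A B where AB: "A \<union> B = verts G" "A \<inter> B = {}" "card A = n" "card B = n"
    and E: "\<forall>e \<in> edges G. \<exists>a \<in> A. \<exists>b \<in> B. e = {a, b}"
    using G by (auto simp: balanced_bipartite_def)
  have injAB: "inj_on f A" "inj_on f B" using f AB(1) by (auto intro: inj_on_subset)
  have "f ` A \<inter> f ` B = {}"
    using f AB(1,2) by (metis Un_upper1 Un_upper2 image_empty inj_on_image_Int)
  moreover have "\<forall>e \<in> edges G'. \<exists>a \<in> f ` A. \<exists>b \<in> f ` B. e = {a, b}"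
    using E unfolding G'_def by fastforce
  moreover have "f ` A \<union> f ` B = verts G'" using AB(1) by (auto simp: G'_def)
  moreover have "card (f ` A) = n" "card (f ` B) = n"
    using injAB AB(3,4) by (simp_all add: card_image)
  ultimately have "balanced_bipartite n G'"
    unfolding balanced_bipartite_def using simple' by blast
  moreover have "graph_free F G'"
  proof (rule ccontr)
    assume "\<not> graph_free F G'"
    then obtain h where h: "inj_on h (verts F)" "h ` verts F \<subseteq> f ` verts G"
      "\<forall>e \<in> edges F. h ` e \<in> (`) f ` edges G"
      unfolding graph_free_iff_no_embedding[OF F] by (auto simp: G'_def embeds_def)
    have "inj_on g (f ` verts G)" by (simp add: g_def inj_on_inv_into)
    then have "inj_on (g \<circ> h) (verts F)"
      using h(1,2) by (meson comp_inj_on inj_on_subset)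
    moreover have "g ` (f ` verts G) \<subseteq> verts G" using f by (simp add: g_def)
    then have "(g \<circ> h) ` verts F \<subseteq> verts G"
      using h(2) by fastforce
    moreover have "(g \<circ> h) ` e \<in> edges G" if "e \<in> edges F" for e
    proof -
      obtain e' where "h ` e = f ` e'" "e' \<in> edges G" using h(3) \<open>e \<in> edges F\<close> by (metis imageE)
      then show ?thesis using gf[of e'] by (simp only: image_comp[symmetric])
    qed
    ultimately show False
      using free unfolding graph_free_iff_no_embedding[OF F] embeds_def by blast
  qed
  moreover have "inj_on ((`) f) (edges G)" by (metis gf inj_onI)
  then have "card (edges G') = card (edges G)" by (simp add: G'_def card_image)
  ultimately show ?thesis by blast
qed

lemma ex_b_eqI:
  fixes G :: "'a graph"
  assumes "simple_graph F" "balanced_bipartite n G" "graph_free F G" "card (edges G) = m"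
    and le: "\<And>G :: nat graph. balanced_bipartite n G \<Longrightarrow> graph_free F G \<Longrightarrow> card (edges G) \<le> m"
  shows "ex_b n F = m"
  unfolding ex_b_def
proof (rule Max_eqI)
  show "m \<in> {card (edges G) | G :: nat graph. balanced_bipartite n G \<and> graph_free F G}"
    unfolding assms(4)[symmetric] using ex_nat_copy[OF assms(2,3,1)] by force
qed (use le finite_ex_b in auto)

text \<open>Gives access to the maximum without knowing its value: the edgeless graph is F-free
  because F has an edge. This serves the spider with legs 3, 1, 1, whose extremal number is only
  bounded when 3 does not divide n.\<close>

lemma ex_b_attained:
  assumes "edges F \<noteq> {}" "simple_graph F"
  obtains G :: "nat graph" where "extremal_b n F G"
proof -
  define G :: "nat graph" where "G = \<lparr>verts = {..<2 * n}, edges = {}\<rparr>"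
  have "\<exists>A B. A \<union> B = {..<2 * n} \<and> A \<inter> B = {} \<and> card A = n \<and> card B = n"
    by (rule exI[of _ "{..<n}"], rule exI[of _ "{n..<2 * n}"]) auto
  then have "balanced_bipartite n G"
    by (simp add: balanced_bipartite_def simple_graph_def G_def)
  moreover have "graph_free F G"
    using assms unfolding graph_free_iff_no_embedding[OF assms(2)] by (auto simp: G_def embeds_def)
  ultimately have "{card (edges G) | G :: nat graph. balanced_bipartite n G \<and> graph_free F G} \<noteq> {}"
    by blast
  from Max_in[OF finite_ex_b this] show ?thesis
    using that by (force simp: ex_b_def extremal_b_def)
qed

section \<open>The three forbidden trees\<close>

lemma set_of_pairs: "{f i j | i j. (i, j) \<in> R} = (\<lambda>(i, j). f i j) ` R"
  by force

lemma spider_311: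
  "spider [3, 1, 1] = \<lparr>verts = {(0, 0), (0, 1), (0, 2), (0, 3), (1, 1), (2, 1)},
    edges = {{(0, 0), (0, 1)}, {(0, 1), (0, 2)}, {(0, 2), (0, 3)}, {(0, 0), (1, 1)},
      {(0, 0), (2, 1)}}\<rparr>"
proof -
  \<comment> \<open>The pairs (1, 0), (2, 0), (0, 0) are listed together because
    \<open>leg_vertex\<close> maps all three to the centre, and adjacent equal elements collapse
    under simplification.\<close>
  have le: "i < length [3, 1, 1::nat] \<and> j \<le> [3, 1, 1] ! i \<longleftrightarrow>
    (i, j) \<in> {(1, 0), (2, 0), (0, 0), (0, 1), (0, 2), (0, 3), (1, 1), (2, 1)}" for i j :: nat
    by (auto simp: nth_Cons less_Suc_eq split: nat.splits)
  have less: "i < length [3, 1, 1::nat] \<and> j < [3, 1, 1] ! i \<longleftrightarrow>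
    (i, j) \<in> {(0, 0), (0, 1), (0, 2), (1, 0), (2, 0)}" for i j :: nat
    by (auto simp: nth_Cons less_Suc_eq split: nat.splits)
  have "{leg_vertex i j | i j. i < length [3, 1, 1::nat] \<and> j \<le> [3, 1, 1] ! i} =
    (\<lambda>(i, j). leg_vertex i j) `
      {(1, 0), (2, 0), (0, 0), (0, 1), (0, 2), (0, 3), (1, 1), (2, 1)}"
    unfolding le by (rule set_of_pairs)
  moreover have "{{leg_vertex i j, leg_vertex i (Suc j)} | i j.
      i < length [3, 1, 1::nat] \<and> j < [3, 1, 1] ! i} =
    (\<lambda>(i, j). {leg_vertex i j, leg_vertex i (Suc j)}) ` {(0, 0), (0, 1), (0, 2), (1, 0), (2, 0)}"
    unfolding less by (rule set_of_pairs)
  ultimately show ?thesis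
    unfolding spider_def by (simp add: leg_vertex_def eval_nat_numeral)
qed

lemma spider_221:
  "spider [2, 2, 1] = \<lparr>verts = {(0, 0), (0, 1), (0, 2), (1, 1), (1, 2), (2, 1)},
    edges = {{(0, 0), (0, 1)}, {(0, 1), (0, 2)}, {(0, 0), (1, 1)}, {(1, 1), (1, 2)},
      {(0, 0), (2, 1)}}\<rparr>"
proof -
  have le: "i < length [2, 2, 1::nat] \<and> j \<le> [2, 2, 1] ! i \<longleftrightarrow>
    (i, j) \<in> {(1, 0), (2, 0), (0, 0), (0, 1), (0, 2), (1, 1), (1, 2), (2, 1)}" for i j :: nat
    by (auto simp: nth_Cons less_Suc_eq split: nat.splits)
  have less: "i < length [2, 2, 1::nat] \<and> j < [2, 2, 1] ! i \<longleftrightarrow>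
    (i, j) \<in> {(0, 0), (0, 1), (1, 0), (1, 1), (2, 0)}" for i j :: nat
    by (auto simp: nth_Cons less_Suc_eq split: nat.splits)
  have "{leg_vertex i j | i j. i < length [2, 2, 1::nat] \<and> j \<le> [2, 2, 1] ! i} =
    (\<lambda>(i, j). leg_vertex i j) `
      {(1, 0), (2, 0), (0, 0), (0, 1), (0, 2), (1, 1), (1, 2), (2, 1)}"
    unfolding le by (rule set_of_pairs)
  moreover have "{{leg_vertex i j, leg_vertex i (Suc j)} | i j.
      i < length [2, 2, 1::nat] \<and> j < [2, 2, 1] ! i} =
    (\<lambda>(i, j). {leg_vertex i j, leg_vertex i (Suc j)}) ` {(0, 0), (0, 1), (1, 0), (1, 1), (2, 0)}"
    unfolding less by (rule set_of_pairs)
  ultimately show ?thesis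
    unfolding spider_def by (simp add: leg_vertex_def eval_nat_numeral)
qed

lemma double_star_22:
  "double_star 2 2 = \<lparr>verts = {(False, 0), (False, 1), (False, 2), (True, 0), (True, 1), (True, 2)},
    edges = {{(False, 0), (True, 0)}, {(False, 0), (False, 1)}, {(False, 0), (False, 2)},
      {(True, 0), (True, 1)}, {(True, 0), (True, 2)}}\<rparr>"
proof -
  have "{0..2} = {0, 1, 2::nat}" "{1..2} = {1, 2::nat}" by auto
  moreover have "{f i | i. i \<in> {1, 2::nat}} = {f 1, f 2}" for f :: "nat \<Rightarrow> (bool \<times> nat) set"
    by blast
  ultimately show ?thesis unfolding double_star_def by (simp add: insert_commute)
qed

lemma simple_forbidden:
  "simple_graph (spider [3, 1, 1])" "simple_graph (spider [2, 2, 1])"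
  "simple_graph (double_star 2 2)"
  unfolding spider_311 spider_221 double_star_22 by (simp_all add: simple_graph_def)

text \<open>Six named vertices replace the coordinates of \<open>spider\<close> once and for all.
  Membership in \<open>verts G\<close> comes from simplicity, as each of the six lies on an
  edge.\<close>

lemma free_spider_311_iff:
  assumes "simple_graph G"
  shows "graph_free (spider [3, 1, 1]) G \<longleftrightarrow>
    \<not> (\<exists>c a b d x y. distinct [c, a, b, d, x, y] \<and>
      {c, a} \<in> edges G \<and> {a, b} \<in> edges G \<and> {b, d} \<in> edges G \<and> {c, x} \<in> edges G \<and> {c, y} \<in> edges G)"
    (is "_ \<longleftrightarrow> \<not> ?R")
proof -
  have "embeds (spider [3, 1, 1]) G" if ?R
  proof -
    obtain c a b d x y where *: "distinct [c, a, b, d, x, y]"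
      "{c, a} \<in> edges G" "{a, b} \<in> edges G" "{b, d} \<in> edges G" "{c, x} \<in> edges G" "{c, y} \<in> edges G"
      using \<open>?R\<close> by blast
    \<comment> \<open>The default value y is the image of the one tree vertex that is not updated,
      (2, 1).\<close>
    define f where "f = (\<lambda>_ :: nat \<times> nat. y)
      ((0, 0) := c, (0, 1) := a, (0, 2) := b, (0, 3) := d, (1, 1) := x)"
    have "{c, a, b, d, x, y} \<subseteq> verts G"
      using * assms unfolding simple_graph_def by blast
    then have "f ` verts (spider [3, 1, 1]) \<subseteq> verts G"
      unfolding spider_311 by (simp add: f_def)
    moreover have "inj_on f (verts (spider [3, 1, 1]))"
      using *(1) unfolding spider_311 by (auto simp: f_def)
    moreover have "\<forall>e \<in> edges (spider [3, 1, 1]). f ` e \<in> edges G"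
      using * unfolding spider_311 by (auto simp: f_def insert_commute)
    ultimately show ?thesis unfolding embeds_def by blast
  qed
  moreover have ?R if "embeds (spider [3, 1, 1]) G"
  proof -
    obtain f where f: "inj_on f (verts (spider [3, 1, 1]))"
      "\<forall>e \<in> edges (spider [3, 1, 1]). f ` e \<in> edges G"
      using \<open>embeds (spider [3, 1, 1]) G\<close> unfolding embeds_def by blast
    have "distinct [f (0, 0), f (0, 1), f (0, 2), f (0, 3), f (1, 1), f (2, 1)]"
      using f(1) unfolding spider_311 by (simp add: inj_on_def)
    moreover have "{f (0, 0), f (0, 1)} \<in> edges G \<and>
        {f (0, 1), f (0, 2)} \<in> edges G \<and>
        {f (0, 2), f (0, 3)} \<in> edges G \<and>
        {f (0, 0), f (1, 1)} \<in> edges G \<and>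
        {f (0, 0), f (2, 1)} \<in> edges G"
      using f(2) unfolding spider_311 by simp
    ultimately show ?R by blast
  qed
  ultimately show ?thesis
    unfolding graph_free_iff_no_embedding[OF simple_forbidden(1)] by argo
qed

lemma free_spider_221_iff:
  assumes "simple_graph G"
  shows "graph_free (spider [2, 2, 1]) G \<longleftrightarrow>
    \<not> (\<exists>c a b a' b' x. distinct [c, a, b, a', b', x] \<and>
      {c, a} \<in> edges G \<and> {a, b} \<in> edges G \<and> {c, a'} \<in> edges G \<and> {a', b'} \<in> edges G \<and> {c, x} \<in> edges G)"
    (is "_ \<longleftrightarrow> \<not> ?R")
proof -
  have "embeds (spider [2, 2, 1]) G" if ?R
  proof -
    obtain c a b a' b' x where *: "distinct [c, a, b, a', b', x]"
      "{c, a} \<in> edges G" "{a, b} \<in> edges G" "{c, a'} \<in> edges G" "{a', b'} \<in> edges G" "{c, x} \<in> edges G"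
      using \<open>?R\<close> by blast
    define f where "f = (\<lambda>_ :: nat \<times> nat. x)
      ((0, 0) := c, (0, 1) := a, (0, 2) := b, (1, 1) := a', (1, 2) := b')"
    have "{c, a, b, a', b', x} \<subseteq> verts G"
      using * assms unfolding simple_graph_def by blast
    then have "f ` verts (spider [2, 2, 1]) \<subseteq> verts G"
      unfolding spider_221 by (simp add: f_def)
    moreover have "inj_on f (verts (spider [2, 2, 1]))"
      using *(1) unfolding spider_221 by (auto simp: f_def)
    moreover have "\<forall>e \<in> edges (spider [2, 2, 1]). f ` e \<in> edges G"
      using * unfolding spider_221 by (auto simp: f_def insert_commute)
    ultimately show ?thesis unfolding embeds_def by blast
  qed
  moreover have ?R if "embeds (spider [2, 2, 1]) G"
  proof -
    obtain f where f: "inj_on f (verts (spider [2, 2, 1]))"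
      "\<forall>e \<in> edges (spider [2, 2, 1]). f ` e \<in> edges G"
      using \<open>embeds (spider [2, 2, 1]) G\<close> unfolding embeds_def by blast
    have "distinct [f (0, 0), f (0, 1), f (0, 2), f (1, 1), f (1, 2), f (2, 1)]"
      using f(1) unfolding spider_221 by (simp add: inj_on_def)
    moreover have "{f (0, 0), f (0, 1)} \<in> edges G \<and>
        {f (0, 1), f (0, 2)} \<in> edges G \<and>
        {f (0, 0), f (1, 1)} \<in> edges G \<and>
        {f (1, 1), f (1, 2)} \<in> edges G \<and>
        {f (0, 0), f (2, 1)} \<in> edges G"
      using f(2) unfolding spider_221 by simp
    ultimately show ?R by blast
  qed
  ultimately show ?thesis
    unfolding graph_free_iff_no_embedding[OF simple_forbidden(2)] by argo
qed

lemma free_double_star_22_iff: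
  assumes "simple_graph G"
  shows "graph_free (double_star 2 2) G \<longleftrightarrow>
    \<not> (\<exists>u v a b c d. distinct [u, v, a, b, c, d] \<and>
      {u, v} \<in> edges G \<and> {u, a} \<in> edges G \<and> {u, b} \<in> edges G \<and> {v, c} \<in> edges G \<and> {v, d} \<in> edges G)"
    (is "_ \<longleftrightarrow> \<not> ?R")
proof -
  have "embeds (double_star 2 2) G" if ?R
  proof -
    obtain u v a b c d where *: "distinct [u, v, a, b, c, d]"
      "{u, v} \<in> edges G" "{u, a} \<in> edges G" "{u, b} \<in> edges G" "{v, c} \<in> edges G" "{v, d} \<in> edges G"
      using \<open>?R\<close> by blast
    define f where "f = (\<lambda>_ :: bool \<times> nat. d)
      ((False, 0) := u, (True, 0) := v, (False, 1) := a, (False, 2) := b, (True, 1) := c)"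
    have "{u, v, a, b, c, d} \<subseteq> verts G"
      using * assms unfolding simple_graph_def by blast
    then have "f ` verts (double_star 2 2) \<subseteq> verts G"
      by (simp add: double_star_22 f_def)
    moreover have "inj_on f (verts (double_star 2 2))"
      using *(1) unfolding double_star_22 by (auto simp: f_def)
    moreover have "\<forall>e \<in> edges (double_star 2 2). f ` e \<in> edges G"
      using * unfolding double_star_22 by (auto simp: f_def insert_commute)
    ultimately show ?thesis unfolding embeds_def by blast
  qed
  moreover have ?R if "embeds (double_star 2 2) G"
  proof -
    obtain f where f: "inj_on f (verts (double_star 2 2))"
      "\<forall>e \<in> edges (double_star 2 2). f ` e \<in> edges G"
      using \<open>embeds (double_star 2 2) G\<close> unfolding embeds_def by blast
    have "distinct [f (False, 0), f (True, 0), f (False, 1), f (False, 2), f (True, 1), f (True, 2)]"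
      using f(1) unfolding double_star_22 by (simp add: inj_on_def)
    moreover have "{f (False, 0), f (True, 0)} \<in> edges G \<and>
        {f (False, 0), f (False, 1)} \<in> edges G \<and>
        {f (False, 0), f (False, 2)} \<in> edges G \<and>
        {f (True, 0), f (True, 1)} \<in> edges G \<and>
        {f (True, 0), f (True, 2)} \<in> edges G"
      using f(2) unfolding double_star_22 by simp
    ultimately show ?R by blast
  qed
  ultimately show ?thesis
    unfolding graph_free_iff_no_embedding[OF simple_forbidden(3)] by argo
qed

lemma verts_copies_complete:
  "verts (copies k (complete_bipartite s t)) = {..<k} \<times> ({..<s} <+> {..<t})"
  by (simp add: copies_def complete_bipartite_def)

lemma edges_copies_complete:
  "edges (copies k (complete_bipartite s t)) =
    {{(i, Inl p), (i, Inr q)} | i p q. i < k \<and> p < s \<and> q < t}"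
proof -
  have "{(i, Inl p), (i, Inr q)} = Pair i ` {Inl p, Inr q}" for i p q :: nat by simp
  then show ?thesis by (simp only: copies_def complete_bipartite_def select_convs) blast
qed

section \<open>Bipartite edge sets\<close>

definition nbrs :: "'a set set \<Rightarrow> 'a \<Rightarrow> 'a set" where
  "nbrs E v = {u. {v, u} \<in> E}"

abbreviation deg :: "'a set set \<Rightarrow> 'a \<Rightarrow> nat" where
  "deg E v \<equiv> card (nbrs E v)"

lemma nbrs_sym: "u \<in> nbrs E v \<longleftrightarrow> v \<in> nbrs E u"
  by (simp add: nbrs_def insert_commute)

text \<open>The sides are named but may differ in size: vertex deletion makes them unequal, and
  \<open>swap\<close> turns every statement about A into one about B.\<close>

locale bigraph =
  fixes A B :: "'a set" and E :: "'a set set"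
  assumes finite_A: "finite A" and finite_B: "finite B" and disjoint: "A \<inter> B = {}"
    and edge_cases: "e \<in> E \<Longrightarrow> \<exists>a \<in> A. \<exists>b \<in> B. e = {a, b}"
begin

lemma swap: "bigraph B A E"
proof
  show "\<exists>a \<in> B. \<exists>b \<in> A. e = {a, b}" if "e \<in> E" for e
    using edge_cases[OF that] by (metis insert_commute)
qed (use finite_A finite_B disjoint in auto)

lemma nbrs_A: "a \<in> A \<Longrightarrow> nbrs E a \<subseteq> B"
  using edge_cases disjoint unfolding nbrs_def by (fastforce simp: doubleton_eq_iff)

lemma nbrs_B: "b \<in> B \<Longrightarrow> nbrs E b \<subseteq> A"
  using edge_cases disjoint unfolding nbrs_def by (fastforce simp: doubleton_eq_iff)

lemma nbrs_in: "u \<in> nbrs E v \<Longrightarrow> v \<in> A \<and> u \<in> B \<or> v \<in> B \<and> u \<in> A"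
  using edge_cases unfolding nbrs_def by (fastforce simp: doubleton_eq_iff)

lemma finite_nbrs: "finite (nbrs E v)"
  using nbrs_in finite_A finite_B by (metis finite_Un finite_subset subsetI UnI1 UnI2)

lemma edges_eq: "E = (\<lambda>(a, b). {a, b}) ` (SIGMA a:A. nbrs E a)"
  using edge_cases by (auto simp: nbrs_def image_iff)

lemma finite_edges: "finite E"
  by (subst edges_eq) (use finite_A finite_nbrs in auto)

lemma card_edges: "card E = (\<Sum>a\<in>A. deg E a)"
proof -
  have "inj_on (\<lambda>(a, b). {a, b}) (SIGMA a:A. nbrs E a)"
    using nbrs_A disjoint by (fastforce simp: inj_on_def doubleton_eq_iff)
  then have "card E = card (SIGMA a:A. nbrs E a)"
    by (subst edges_eq) (simp add: card_image)
  then show ?thesis using finite_A finite_nbrs by (simp add: card_SigmaI)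
qed

lemma card_edges': "card E = (\<Sum>b\<in>B. deg E b)"
  using bigraph.card_edges[OF swap] .

lemma card_incident: "card {e \<in> E. v \<in> e} = deg E v"
proof -
  have "{e \<in> E. v \<in> e} = (\<lambda>u. {v, u}) ` nbrs E v"
  proof (intro equalityI subsetI)
    fix e assume e: "e \<in> {e \<in> E. v \<in> e}"
    then obtain a b where "e = {a, b}" using edge_cases by blast
    then obtain u where "e = {v, u}" using e by auto
    then show "e \<in> (\<lambda>u. {v, u}) ` nbrs E v" using e by (auto simp: nbrs_def)
  qed (auto simp: nbrs_def)
  moreover have "inj_on (\<lambda>u. {v, u}) (nbrs E v)"
    by (auto simp: inj_on_def doubleton_eq_iff)
  ultimately show ?thesis by (simp add: card_image)
qed

lemma delete_vertex: "bigraph (A - {v}) (B - {v}) {e \<in> E. v \<notin> e}"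
proof
  show "\<exists>a\<in>A - {v}. \<exists>b\<in>B - {v}. e = {a, b}" if "e \<in> {e \<in> E. v \<notin> e}" for e
    using that edge_cases[of e] by blast
qed (use finite_A finite_B disjoint in auto)

end

section \<open>Spiders with legs 3, 1, 1\<close>

text \<open>A property of the edge set alone, hence monotone in it; this is how freeness survives a
  deletion.\<close>

definition has_S311 :: "'a set set \<Rightarrow> bool" where
  "has_S311 E \<longleftrightarrow> (\<exists>c a b d x y. distinct [c, a, b, d, x, y] \<and>
    {c, a} \<in> E \<and> {a, b} \<in> E \<and> {b, d} \<in> E \<and> {c, x} \<in> E \<and> {c, y} \<in> E)"

lemma has_S311_mono: "has_S311 E \<Longrightarrow> E \<subseteq> E' \<Longrightarrow> has_S311 E'"
  unfolding has_S311_def by (meson subsetD)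

lemma card_ge2_obtain:
  assumes "2 \<le> card S"
  obtains x y where "x \<in> S" "y \<in> S" "x \<noteq> y"
  using assms by (metis card_2_iff' obtain_subset_with_card_n subsetD)

lemma card_ge1_obtain:
  assumes "1 \<le> card S"
  obtains x where "x \<in> S"
  using assms by fastforce

context bigraph
begin

text \<open>Sides separate {b, c} from {a, d, x, y}, so the seven inequalities assumed are exactly
  the pairs within a side.\<close>

lemma has_S311I:
  assumes "a \<in> nbrs E c" "b \<in> nbrs E a" "d \<in> nbrs E b" "x \<in> nbrs E c" "y \<in> nbrs E c"
    and "b \<noteq> c" "a \<noteq> d" "x \<noteq> a" "y \<noteq> a" "x \<noteq> d" "y \<noteq> d" "x \<noteq> y"
  shows "has_S311 E"
proof -
  have "{a, d, x, y} \<inter> {b, c} = {}"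
    using assms(1-5)[THEN nbrs_in] disjoint by auto
  then have "distinct [c, a, b, d, x, y]" using assms(6-12) by auto
  with assms(1-5) show ?thesis unfolding has_S311_def nbrs_def by blast
qed

text \<open>Minimum degree 2 lets a path c, a, b, d continue without turning back. Since d may
  itself be a neighbour of c, up to two of the four neighbours are lost to a and d, and two remain
  for the short legs.\<close>

lemma deg_le_3_if_S311_free:
  assumes free: "\<not> has_S311 E" and two: "\<And>v. v \<in> A \<union> B \<Longrightarrow> 2 \<le> deg E v"
  shows "deg E c \<le> 3"
proof (rule ccontr)
  assume "\<not> deg E c \<le> 3"
  then have c: "4 \<le> deg E c" by simp
  then obtain a where a: "a \<in> nbrs E c" using card_ge1_obtain[of "nbrs E c"] by auto
  then have "2 \<le> deg E a" "c \<in> nbrs E a" using two nbrs_in nbrs_sym[of _ E] by blast+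
  then have "1 \<le> card (nbrs E a - {c})" by (simp add: finite_nbrs)
  then obtain b where b: "b \<in> nbrs E a" "b \<noteq> c" using card_ge1_obtain by blast
  then have "2 \<le> deg E b" "a \<in> nbrs E b" using two nbrs_in nbrs_sym[of _ E] by blast+
  then have "1 \<le> card (nbrs E b - {a})" by (simp add: finite_nbrs)
  then obtain d where d: "d \<in> nbrs E b" "d \<noteq> a" using card_ge1_obtain by blast
  have "card (nbrs E c) - card {a, d} \<le> card (nbrs E c - {a, d})"
    by (rule diff_card_le_card_Diff) simp
  then have "2 \<le> card (nbrs E c - {a, d})" using c d(2) by simp
  then obtain x y where "x \<in> nbrs E c - {a, d}" "y \<in> nbrs E c - {a, d}" "x \<noteq> y"
    using card_ge2_obtain by metis
  then show False using has_S311I[of a c b d x y] a b d free by auto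
qed

end

text \<open>Induction on the number of vertices. After deleting a vertex of degree at most 1 the
  inequality becomes strict, so the equality claim is vacuous there. Otherwise all degrees are at
  most 3, and 2e is the degree sum over both sides.\<close>

lemma S311_edge_bound:
  assumes "bigraph A B E" "\<not> has_S311 E"
  shows "2 * card E \<le> 3 * (card A + card B)"
    and "2 * card E = 3 * (card A + card B) \<Longrightarrow> v \<in> A \<union> B \<Longrightarrow> deg E v = 3"
proof -
  have "2 * card E \<le> 3 * (card A + card B) \<and>
    (2 * card E = 3 * (card A + card B) \<longrightarrow> (\<forall>v \<in> A \<union> B. deg E v = 3))"
    using assms
  proof (induction "card A + card B" arbitrary: A B E rule: less_induct)
    case less
    interpret bigraph A B E by fact
    show ?case
    proof (cases "\<exists>v \<in> A \<union> B. deg E v \<le> 1")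
      case True
      then obtain v where v: "v \<in> A \<union> B" "deg E v \<le> 1" by blast
      define E' where "E' = {e \<in> E. v \<notin> e}"
      have A': "card A + card B = Suc (card (A - {v}) + card (B - {v}))"
      proof (cases "v \<in> A")
        case True
        then have "v \<notin> B" using disjoint by blast
        then show ?thesis using card.remove[OF finite_A True] by simp
      next
        case False
        then have "v \<in> B" using v(1) by blast
        then show ?thesis using card.remove[OF finite_B, of v] False by simp
      qed
      moreover have "\<not> has_S311 E'"
        using less.prems(2) has_S311_mono[of E' E] by (auto simp: E'_def)
      ultimately have IH: "2 * card E' \<le> 3 * (card (A - {v}) + card (B - {v}))"
        using less.hyps[of "A - {v}" "B - {v}" E'] delete_vertex[of v] by (auto simp: E'_def)
      have "E = {e \<in> E. v \<in> e} \<union> E'" by (auto simp: E'_def)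
      then have "card E \<le> deg E v + card E'"
        by (metis card_Un_le card_incident)
      then have "2 * card E < 3 * (card A + card B)" using IH A' v(2) by presburger
      then show ?thesis by simp
    next
      case False
      then have "2 \<le> deg E v" if "v \<in> A \<union> B" for v using that by force
      then have three: "deg E v \<le> 3" for v
        using deg_le_3_if_S311_free less.prems(2) by blast
      have sum: "2 * card E = (\<Sum>v\<in>A \<union> B. deg E v)"
        using card_edges card_edges' finite_A finite_B disjoint by (simp add: sum.union_disjoint)
      have card: "3 * (card A + card B) = (\<Sum>v\<in>A \<union> B. 3)"
        using finite_A finite_B disjoint by (simp add: card_Un_disjoint)
      have "deg E v = 3" if "2 * card E = 3 * (card A + card B)" "v \<in> A \<union> B" for v
      proof (rule ccontr)
        assume "deg E v \<noteq> 3"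
        then have "deg E v < 3" using three[of v] by simp
        then have "(\<Sum>v\<in>A \<union> B. deg E v) < (\<Sum>v\<in>A \<union> B. 3)"
          using that(2) three finite_A finite_B by (intro sum_strict_mono_ex1) auto
        then show False using that(1) sum card by simp
      qed
      then show ?thesis using sum card sum_mono[of "A \<union> B" "deg E" "\<lambda>_. 3"] three by simp
    qed
  qed
  then show "2 * card E \<le> 3 * (card A + card B)"
    and "2 * card E = 3 * (card A + card B) \<Longrightarrow> v \<in> A \<union> B \<Longrightarrow> deg E v = 3"
    by blast+
qed

section \<open>Structure of the 3-regular case\<close>

context bigraph
begin

text \<open>A neighbour d of b outside the neighbourhood of c would complete a spider: the path c,
  a, b, d and the two other neighbours of c, from which d differs by its choice. Containment is
  equality because both sets have size 3.\<close>

lemma nbrs_eq_if_S311_free: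
  assumes free: "\<not> has_S311 E" and three: "\<And>v. v \<in> A \<union> B \<Longrightarrow> deg E v = 3"
    and a: "a \<in> nbrs E c" and b: "b \<in> nbrs E a"
  shows "nbrs E b = nbrs E c"
proof -
  have deg: "deg E b = 3" "deg E c = 3" using a b nbrs_in three by blast+
  have "d \<in> nbrs E c" if d: "d \<in> nbrs E b" for d
  proof (rule ccontr)
    assume "d \<notin> nbrs E c"
    then have "d \<noteq> a" "b \<noteq> c" using a d by blast+
    have "2 \<le> card (nbrs E c - {a})" using a deg finite_nbrs by simp
    then obtain x y where "x \<in> nbrs E c - {a}" "y \<in> nbrs E c - {a}" "x \<noteq> y"
      using card_ge2_obtain by metis
    then show False
      using has_S311I[of a c b d x y] a b d \<open>d \<noteq> a\<close> \<open>b \<noteq> c\<close> \<open>d \<notin> nbrs E c\<close> free by auto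
  qed
  then show ?thesis using deg finite_nbrs by (metis card_subset_eq subsetI)
qed

text \<open>The distinct neighbourhoods of vertices of B partition A into triples, and each triple X
  is completely joined to the three vertices of B whose neighbourhood is X. The isomorphism numbers
  the triples, then the vertices in each triple and in each such fibre.\<close>

lemma K33_components:
  assumes free: "\<not> has_S311 E" and three: "\<And>v. v \<in> A \<union> B \<Longrightarrow> deg E v = 3"
    and G: "verts G = A \<union> B" "edges G = E"
  shows "\<exists>k. card A = 3 * k \<and> G \<cong>\<^sub>G copies k (complete_bipartite 3 3)"
proof -
  define Q where "Q = nbrs E ` B"
  define k where "k = card Q"
  \<comment> \<open>Any neighbour of a would do: all of them have the same neighbourhood, the block
    of the partition that contains a.\<close>
  define cls where "cls a = nbrs E (SOME b. b \<in> nbrs E a)" for a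
  define fib where "fib X = {b \<in> B. nbrs E b = X}" for X
  have ex_nbr: "\<exists>u. u \<in> nbrs E v" if "v \<in> A \<union> B" for v
    using three[OF that] by (metis card.empty equals0I numeral_eq_iff zero_neq_numeral)
  have cls: "cls a = nbrs E b" if "b \<in> nbrs E a" for a b
  proof -
    have "(SOME b. b \<in> nbrs E a) \<in> nbrs E a" using that by (rule someI)
    then show ?thesis unfolding cls_def
      using nbrs_eq_if_S311_free[OF free three, of a b] that nbrs_sym[of a E b] by blast
  qed
  have in_cls: "a \<in> cls a" "cls a \<in> Q" if "a \<in> A" for a
  proof -
    obtain b where b: "b \<in> nbrs E a" using ex_nbr \<open>a \<in> A\<close> by blast
    then show "a \<in> cls a" using cls[OF b] nbrs_sym by metis
    have "b \<in> B" using nbrs_A that b by blast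
    then show "cls a \<in> Q" using cls[OF b] by (simp add: Q_def)
  qed
  have cls_eq: "cls a = X" if "X \<in> Q" "a \<in> X" for a X
  proof -
    obtain b where b: "X = nbrs E b" using \<open>X \<in> Q\<close> by (auto simp: Q_def)
    then have "b \<in> nbrs E a" using \<open>a \<in> X\<close> nbrs_sym by metis
    then show ?thesis using cls b by simp
  qed
  have Q_sub: "X \<subseteq> A" "card X = 3" if "X \<in> Q" for X
    using that nbrs_B three unfolding Q_def by blast+
  \<comment> \<open>Seen from any member of X, the fibre is a neighbourhood, and so has size 3 like
    the blocks.\<close>
  have fib: "fib X = nbrs E a" if "X \<in> Q" "a \<in> X" for a X
  proof -
    have "a \<in> A" using Q_sub(1) that by blast
    then have "b \<in> B \<and> nbrs E b = X \<longleftrightarrow> b \<in> nbrs E a" for b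
      using nbrs_A[of a] cls_eq[OF that] cls[of b a] that(2) nbrs_sym[of a E b] by blast
    then show ?thesis by (auto simp: fib_def)
  qed
  have card_fib: "card (fib X) = 3" if "X \<in> Q" for X
  proof -
    obtain a where "a \<in> X" using Q_sub(2)[OF \<open>X \<in> Q\<close>] by fastforce
    then show ?thesis using fib[OF that] Q_sub(1)[OF that] three by auto
  qed
  have fin: "finite Q" "finite X" "finite (fib X)" if "X \<in> Q" for X
    using finite_B finite_A Q_sub(1)[OF that] finite_subset by (auto simp: Q_def fib_def)
  have finQ: "finite Q" using finite_B by (simp add: Q_def)
  have "A = \<Union>Q" using in_cls Q_sub(1) by blast
  moreover have "pairwise disjnt Q"
    unfolding pairwise_def disjnt_iff by (metis cls_eq)
  ultimately have cardA: "card A = 3 * k"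
    using card_Union_disjoint[of Q] Q_sub(2) fin(2) finQ by (simp add: k_def)
  obtain g where g: "bij_betw g Q {..<k}"
    using finQ unfolding k_def by (metis atLeast0LessThan ex_bij_betw_finite_nat)
  have "\<forall>X. \<exists>h. X \<in> Q \<longrightarrow> bij_betw h X {..<3::nat}"
    using Q_sub(2) fin by (metis atLeast0LessThan ex_bij_betw_finite_nat)
  then obtain h where h: "\<And>X. X \<in> Q \<Longrightarrow> bij_betw (h X) X {..<3::nat}" by metis
  have "\<forall>X. \<exists>h. X \<in> Q \<longrightarrow> bij_betw h (fib X) {..<3::nat}"
    using card_fib fin by (metis atLeast0LessThan ex_bij_betw_finite_nat)
  then obtain h' where h': "\<And>X. X \<in> Q \<Longrightarrow> bij_betw (h' X) (fib X) {..<3::nat}" by metis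
  define f where "f v = (if v \<in> A then (g (cls v), Inl (h (cls v) v))
    else (g (nbrs E v), Inr (h' (nbrs E v) v)))" for v
  have fA: "f a = (g (cls a), Inl (h (cls a) a))" if "a \<in> A" for a
    using that by (simp add: f_def)
  have fB: "f b = (g (nbrs E b), Inr (h' (nbrs E b) b))" if "b \<in> B" for b
    using that disjoint by (auto simp: f_def)
  have nbrsQ: "nbrs E b \<in> Q" "b \<in> fib (nbrs E b)" if "b \<in> B" for b
    using that by (auto simp: Q_def fib_def)
  have gQ: "g X < k" if "X \<in> Q" for X using g that by (auto simp: bij_betw_def)
  have hQ: "h X a < 3" if "X \<in> Q" "a \<in> X" for X a using h[OF that(1)] that(2) by (auto simp: bij_betw_def)
  have h'Q: "h' X a < 3" if "X \<in> Q" "a \<in> fib X" for X a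
    using h'[OF that(1)] that(2) by (auto simp: bij_betw_def)
  have g_inj: "X = Y" if "X \<in> Q" "Y \<in> Q" "g X = g Y" for X Y
    using g that by (auto simp: bij_betw_def dest: inj_onD)
  \<comment> \<open>Hitting every edge of the target also hits every vertex, since each vertex of a
    copy lies on an edge; the fact serves both purposes.\<close>
  have onto: "\<exists>a b. {a, b} \<in> E \<and> a \<in> A \<and> b \<in> B \<and> f a = (i, Inl p) \<and> f b = (i, Inr q)"
    if ipq: "i < k" "p < 3" "q < 3" for i p q
  proof -
    obtain X where X: "X \<in> Q" "g X = i" using g ipq(1) by (metis bij_betw_imp_surj_on imageE lessThan_iff)
    obtain a where a: "a \<in> X" "h X a = p" using h[OF X(1)] ipq(2) by (metis bij_betw_imp_surj_on imageE lessThan_iff)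
    obtain b where b: "b \<in> fib X" "h' X b = q" using h'[OF X(1)] ipq(3) by (metis bij_betw_imp_surj_on imageE lessThan_iff)
    have "a \<in> A" "cls a = X" using a(1) X(1) Q_sub(1) cls_eq by blast+
    moreover have "b \<in> B" "nbrs E b = X" using b(1) by (auto simp: fib_def)
    moreover have "{a, b} \<in> E" using a(1) \<open>nbrs E b = X\<close> by (auto simp: nbrs_def insert_commute)
    moreover from calculation have "f a = (i, Inl p)" "f b = (i, Inr q)"
      using fA fB X(2) a(2) b(2) by simp_all
    ultimately show ?thesis by blast
  qed
  have "inj_on f (A \<union> B)"
  proof (rule inj_onI)
    fix u v assume uv: "u \<in> A \<union> B" "v \<in> A \<union> B" "f u = f v"
    consider "u \<in> A" "v \<in> A" | "u \<in> B" "v \<in> B"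
      using uv fA fB by fastforce
    then show "u = v"
    proof cases
      case 1
      then have "cls u = cls v" using uv(3) fA in_cls g_inj by simp
      moreover from this have "h (cls u) u = h (cls u) v" using 1 uv(3) fA by simp
      moreover have "inj_on (h (cls u)) (cls u)" using h in_cls(2) 1 by (auto simp: bij_betw_def)
      ultimately show ?thesis using 1 in_cls(1) by (metis inj_onD)
    next
      case 2
      then have "nbrs E u = nbrs E v" using uv(3) fB nbrsQ g_inj by simp
      moreover from this have "h' (nbrs E u) u = h' (nbrs E u) v" using 2 uv(3) fB by simp
      moreover have "inj_on (h' (nbrs E u)) (fib (nbrs E u))"
        using h' nbrsQ(1) 2 by (auto simp: bij_betw_def)
      ultimately show ?thesis using 2 nbrsQ(2) by (metis inj_onD)
    qed
  qed
  moreover have "f ` (A \<union> B) = verts (copies k (complete_bipartite 3 3))"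
  proof (intro equalityI subsetI)
    fix w assume "w \<in> f ` (A \<union> B)"
    then show "w \<in> verts (copies k (complete_bipartite 3 3))"
      using fA fB in_cls nbrsQ gQ hQ h'Q by (auto simp: verts_copies_complete)
  next
    fix w assume "w \<in> verts (copies k (complete_bipartite 3 3))"
    then consider i p where "w = (i, Inl p)" "i < k" "p < 3" | i p where "w = (i, Inr p)" "i < k" "p < 3"
      by (auto simp: verts_copies_complete)
    then show "w \<in> f ` (A \<union> B)"
      by cases (metis onto UnI1 UnI2 image_eqI)+
  qed
  moreover have "edges (copies k (complete_bipartite 3 3)) = (`) f ` E"
  proof (intro equalityI subsetI)
    fix e assume "e \<in> (`) f ` E"
    then obtain a b where "a \<in> A" "b \<in> B" "{a, b} \<in> E" "e = {f a, f b}"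
      using edge_cases by force
    moreover from this have "cls a = nbrs E b" using cls by (simp add: nbrs_def)
    moreover from calculation have "h (nbrs E b) a < 3" using hQ in_cls by metis
    ultimately have "e = {(g (cls a), Inl (h (cls a) a)), (g (cls a), Inr (h' (cls a) b))}"
      "g (cls a) < k" "h (cls a) a < 3" "h' (cls a) b < 3"
      using fA fB in_cls nbrsQ gQ hQ h'Q by auto
    then show "e \<in> edges (copies k (complete_bipartite 3 3))"
      unfolding edges_copies_complete by blast
  next
    fix e assume "e \<in> edges (copies k (complete_bipartite 3 3))"
    then obtain i p q where "e = {(i, Inl p), (i, Inr q)}" "i < k" "p < 3" "q < 3"
      by (auto simp: edges_copies_complete)
    moreover from this obtain a b where "{a, b} \<in> E" "f a = (i, Inl p)" "f b = (i, Inr q)"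
      using onto by metis
    ultimately have "e = f ` {a, b}" "{a, b} \<in> E" by simp_all
    then show "e \<in> (`) f ` E" by blast
  qed
  ultimately show ?thesis
    using cardA G unfolding graph_iso_def bij_betw_def by metis
qed

end

section \<open>Lower bound constructions\<close>

lemma balanced_bipartite_bigraph:
  assumes "balanced_bipartite n G"
  obtains A B where "bigraph A B (edges G)" "verts G = A \<union> B" "card A = n" "card B = n"
proof -
  obtain A B where "A \<union> B = verts G" "A \<inter> B = {}" "card A = n" "card B = n"
    and "\<forall>e \<in> edges G. \<exists>a \<in> A. \<exists>b \<in> B. e = {a, b}"
    using assms by (auto simp: balanced_bipartite_def)
  moreover have "finite (verts G)"
    using assms by (simp add: balanced_bipartite_def simple_graph_def)
  then have "finite A" "finite B"
    using calculation(1) by (metis finite_Un)+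
  ultimately show ?thesis using that[of A B] by (simp add: bigraph_def)
qed

lemma (in bigraph) balanced_bipartiteI:
  assumes "card A = n" "card B = n" "verts G = A \<union> B" "edges G = E"
  shows "balanced_bipartite n G"
proof -
  have "e \<subseteq> A \<union> B \<and> card e = 2" if "e \<in> E" for e
    using edge_cases[OF that] disjoint by (metis card_2_iff disjoint_iff empty_subsetI insert_subset UnI1 UnI2)
  then have "simple_graph G" using assms finite_A finite_B by (simp add: simple_graph_def)
  then show ?thesis
    using assms disjoint edge_cases unfolding balanced_bipartite_def by metis
qed

lemma free_spider_311_iff_has_S311:
  "simple_graph G \<Longrightarrow> graph_free (spider [3, 1, 1]) G \<longleftrightarrow> \<not> has_S311 (edges G)"
  by (simp only: free_spider_311_iff has_S311_def)

text \<open>Each centre of the double star has three neighbours, too many for a covering set of size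
  2. Exhibiting such a set avoids computing degrees in the concrete graphs.\<close>

lemma free_double_star_22I:
  assumes G: "simple_graph G"
    and low: "\<And>u v. {u, v} \<in> edges G \<Longrightarrow> \<exists>S. card S \<le> 2 \<and> finite S \<and> (nbrs (edges G) u \<subseteq> S \<or> nbrs (edges G) v \<subseteq> S)"
  shows "graph_free (double_star 2 2) G"
proof -
  have False if d: "distinct [u, v, a, b, c, d]" and "{u, v} \<in> edges G"
    "{u, a} \<in> edges G" "{u, b} \<in> edges G" "{v, c} \<in> edges G" "{v, d} \<in> edges G" for u v a b c d
  proof -
    note e = that(2-)
    obtain S where S: "card S \<le> 2" "finite S" "nbrs (edges G) u \<subseteq> S \<or> nbrs (edges G) v \<subseteq> S"
      using low e(1) by blast
    have "{v, a, b} \<subseteq> nbrs (edges G) u" "{u, c, d} \<subseteq> nbrs (edges G) v"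
      using e by (simp_all add: nbrs_def insert_commute)
    then have "{v, a, b} \<subseteq> S \<or> {u, c, d} \<subseteq> S" using S(3) by blast
    moreover have "card {v, a, b} = 3" "card {u, c, d} = 3" using d by auto
    ultimately show False using S(1,2) by (metis card_mono eval_nat_numeral(3) le_trans not_less_eq_eq)
  qed
  then show ?thesis unfolding free_double_star_22_iff[OF G] by blast
qed

text \<open>The centre c has three neighbours, and the middle vertices of its long legs together see
  the three vertices c, b, b'. A common cover of size 2 for either set is impossible.\<close>

lemma free_spider_221I:
  assumes G: "simple_graph G"
    and low: "\<And>c. \<exists>S. card S \<le> 2 \<and> finite S \<and>
      (nbrs (edges G) c \<subseteq> S \<or> (\<forall>a \<in> nbrs (edges G) c. nbrs (edges G) a \<subseteq> S))"
  shows "graph_free (spider [2, 2, 1]) G"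
proof -
  have False if d: "distinct [c, a, b, a', b', x]" and "{c, a} \<in> edges G"
    "{a, b} \<in> edges G" "{c, a'} \<in> edges G" "{a', b'} \<in> edges G" "{c, x} \<in> edges G" for c a b a' b' x
  proof -
    note e = that(2-)
    obtain S where S: "card S \<le> 2" "finite S"
      "nbrs (edges G) c \<subseteq> S \<or> (\<forall>a \<in> nbrs (edges G) c. nbrs (edges G) a \<subseteq> S)"
      using low by blast
    have "{a, a', x} \<subseteq> nbrs (edges G) c" "{c, b} \<subseteq> nbrs (edges G) a" "{c, b'} \<subseteq> nbrs (edges G) a'"
      using e by (simp_all add: nbrs_def insert_commute)
    moreover have "a \<in> nbrs (edges G) c" "a' \<in> nbrs (edges G) c"
      using e by (simp_all add: nbrs_def)
    ultimately have "{a, a', x} \<subseteq> S \<or> {c, b, b'} \<subseteq> S"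
      using S(3) by (metis insert_subset order_trans)
    moreover have "card {a, a', x} = 3" "card {c, b, b'} = 3" using d by auto
    ultimately show False using S(1,2) by (metis card_mono eval_nat_numeral(3) le_trans not_less_eq_eq)
  qed
  then show ?thesis unfolding free_spider_221_iff[OF G] by blast
qed

section \<open>Copies of complete bipartite graphs\<close>

lemma nbrs_copies_complete:
  "nbrs (edges (copies k (complete_bipartite s t))) (i, Inl p) =
    (if i < k \<and> p < s then (\<lambda>q. (i, Inr q)) ` {..<t} else {})"
  "nbrs (edges (copies k (complete_bipartite s t))) (i, Inr q) =
    (if i < k \<and> q < t then (\<lambda>p. (i, Inl p)) ` {..<s} else {})"
  unfolding nbrs_def edges_copies_complete by (auto simp: doubleton_eq_iff)

lemma card_edges_copies_complete: "card (edges (copies k (complete_bipartite s t))) = k * s * t"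
proof -
  have "edges (copies k (complete_bipartite s t)) =
    (\<lambda>(i, p, q). {(i, Inl p), (i, Inr q)}) ` ({..<k} \<times> {..<s} \<times> {..<t})"
    unfolding edges_copies_complete by force
  moreover have "inj_on (\<lambda>(i, p, q). {(i :: nat, Inl p), (i, Inr q)}) ({..<k} \<times> {..<s} \<times> {..<t})"
    by (auto simp: inj_on_def doubleton_eq_iff)
  ultimately show ?thesis by (simp add: card_image card_cartesian_product)
qed

lemma simple_copies_complete: "simple_graph (copies k (complete_bipartite s t))"
  unfolding simple_graph_def verts_copies_complete edges_copies_complete by auto

lemma balanced_copies_K33: "balanced_bipartite (3 * k) (copies k (complete_bipartite 3 3))"
proof (rule bigraph.balanced_bipartiteI)
  let ?A = "(\<lambda>(i, p). (i, Inl p)) ` ({..<k} \<times> {..<3 :: nat})"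
  let ?B = "(\<lambda>(i, p). (i, Inr p)) ` ({..<k} \<times> {..<3 :: nat})"
  show "bigraph ?A ?B (edges (copies k (complete_bipartite 3 3)))"
    by unfold_locales (auto simp: edges_copies_complete)
  show "card ?A = 3 * k" "card ?B = 3 * k"
    by (subst card_image; force simp: inj_on_def card_cartesian_product)+
  show "verts (copies k (complete_bipartite 3 3)) = ?A \<union> ?B"
    by (auto simp: verts_copies_complete image_iff)
qed simp

text \<open>A path c, a, b stays inside one copy, so b and c have the same three neighbours, and a,
  d, x, y would be four of them.\<close>

lemma free_copies_K33: "graph_free (spider [3, 1, 1]) (copies k (complete_bipartite 3 3))"
proof -
  let ?G = "copies k (complete_bipartite 3 3)"
  let ?N = "nbrs (edges ?G)"
  have False if d: "distinct [c, a, b, d, x, y]" and e: "{c, a} \<in> edges ?G"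
    "{a, b} \<in> edges ?G" "{b, d} \<in> edges ?G" "{c, x} \<in> edges ?G" "{c, y} \<in> edges ?G" for c a b d x y
  proof -
    have n: "a \<in> ?N c" "b \<in> ?N a" "d \<in> ?N b" "x \<in> ?N c" "y \<in> ?N c"
      using e by (simp_all add: nbrs_def)
    obtain i p where c: "c = (i, Inl p) \<or> c = (i, Inr p)" by (metis old.prod.exhaust sum.exhaust)
    then have "?N b = ?N c"
      using n(1,2) by (auto simp: nbrs_copies_complete split: if_splits)
    then have "{a, d, x, y} \<subseteq> ?N c" using n by simp
    moreover have "finite (?N c)" "card (?N c) \<le> 3"
      using c by (auto simp: nbrs_copies_complete card_image inj_on_def)
    ultimately have "card {a, d, x, y} \<le> 3" by (meson card_mono le_trans)
    then show False using d by simp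
  qed
  then show ?thesis unfolding free_spider_311_iff[OF simple_copies_complete] by blast
qed

text \<open>Each edge has an end in an \<open>Inr\<close> part, where all neighbours lie in the
  two-element \<open>Inl\<close> part of the same copy; this excludes the double star. For the
  spider, a centre in an \<open>Inr\<close> part has too few neighbours, and the neighbours of a
  centre in an \<open>Inl\<close> part all share the same two.\<close>

lemma copies_K2:
  assumes "2 \<le> n"
  shows "balanced_bipartite n (copies 2 (complete_bipartite 2 (n - 2)))"
    and "graph_free (double_star 2 2) (copies 2 (complete_bipartite 2 (n - 2)))"
    and "graph_free (spider [2, 2, 1]) (copies 2 (complete_bipartite 2 (n - 2)))"
    and "card (edges (copies 2 (complete_bipartite 2 (n - 2)))) = 4 * n - 8"
proof -
  let ?G = "copies 2 (complete_bipartite 2 (n - 2))"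
  let ?N = "nbrs (edges ?G)"
  show "card (edges ?G) = 4 * n - 8" by (simp add: card_edges_copies_complete)
  show "balanced_bipartite n ?G"
  proof (rule bigraph.balanced_bipartiteI)
    \<comment> \<open>The copies are crossed to obtain balance: side i takes the part of size 2 from
      copy i and the part of size n - 2 from the other copy, 1 - i.\<close>
    define side where "side i = (\<lambda>p. (i :: nat, Inl p :: nat + nat)) ` {..<2} \<union>
      (\<lambda>q. (1 - i, Inr q)) ` {..<n - 2}" for i
    show "bigraph (side 0) (side 1) (edges ?G)"
    proof
      show "\<exists>a \<in> side 0. \<exists>b \<in> side 1. e = {a, b}" if "e \<in> edges ?G" for e
      proof -
        obtain i p q where e: "e = {(i, Inl p), (i, Inr q)}" "i < 2" "p < 2" "q < n - 2"
          using \<open>e \<in> edges ?G\<close> by (auto simp: edges_copies_complete)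
        have sides: "(i, Inl p) \<in> side i" "(i, Inr q) \<in> side (1 - i)"
          using e by (auto simp: side_def)
        consider "i = 0" | "i = 1" using e(2) by linarith
        then show ?thesis
        proof cases
          case 1
          then show ?thesis using e(1) sides by auto
        next
          case 2
          then show ?thesis using e(1) sides insert_commute by auto
        qed
      qed
    qed (auto simp: side_def)
    have "card (side i) = n" for i
      unfolding side_def using assms by (subst card_Un_disjoint) (auto simp: card_image inj_on_def)
    then show "card (side 0) = n" "card (side 1) = n" by blast+
    show "verts ?G = side 0 \<union> side 1"
      by (auto simp: side_def verts_copies_complete image_iff less_2_cases_iff)
  qed simp
  have low: "?N (i, Inr q) \<subseteq> {(i, Inl 0), (i, Inl 1)}" for i q
    by (auto simp: nbrs_copies_complete less_2_cases_iff)
  show "graph_free (double_star 2 2) ?G"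
  proof (rule free_double_star_22I[OF simple_copies_complete])
    fix u v assume "{u, v} \<in> edges ?G"
    then obtain i q where "u = (i, Inr q) \<or> v = (i, Inr q)"
      by (auto simp: edges_copies_complete doubleton_eq_iff)
    then show "\<exists>S. card S \<le> 2 \<and> finite S \<and> (?N u \<subseteq> S \<or> ?N v \<subseteq> S)"
      using low by (intro exI[of _ "{(i, Inl 0), (i, Inl 1)}"]) auto
  qed
  show "graph_free (spider [2, 2, 1]) ?G"
  proof (rule free_spider_221I[OF simple_copies_complete])
    fix c :: "nat \<times> (nat + nat)"
    obtain i p where "c = (i, Inl p) \<or> c = (i, Inr p)" by (metis old.prod.exhaust sum.exhaust)
    then have "?N c \<subseteq> {(i, Inl 0), (i, Inl 1)} \<or> (\<forall>a \<in> ?N c. ?N a \<subseteq> {(i, Inl 0), (i, Inl 1)})"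
    proof
      assume c: "c = (i, Inl p)"
      then have "\<exists>q. a = (i, Inr q)" if "a \<in> ?N c" for a
        using that by (auto simp: nbrs_copies_complete(1) split: if_splits)
      then show ?thesis using low by blast
    qed (use low in blast)
    then show "\<exists>S. card S \<le> 2 \<and> finite S \<and> (?N c \<subseteq> S \<or> (\<forall>a \<in> ?N c. ?N a \<subseteq> S))"
      by (intro exI[of _ "{(i, Inl 0), (i, Inl 1)}"]) auto
  qed
qed

section \<open>Explicit graphs for n = 3 and n = 4\<close>

lemma bigraph_of_pairs:
  assumes "finite A" "finite B" "A \<inter> B = {}" "R \<subseteq> A \<times> B"
  shows "bigraph A B ((\<lambda>(a, b). {a, b}) ` R)" (is "bigraph A B ?E")
    and "card ((\<lambda>(a, b). {a, b}) ` R) = card R"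
    and "nbrs ((\<lambda>(a, b). {a, b}) ` R) v = {u. (u, v) \<in> R \<or> (v, u) \<in> R}"
proof -
  show "bigraph A B ?E" using assms by unfold_locales auto
  have "inj_on (\<lambda>(a, b). {a, b}) R"
    using assms(3,4) by (fastforce simp: inj_on_def doubleton_eq_iff)
  then show "card ?E = card R" by (rule card_image)
  show "nbrs ?E v = {u. (u, v) \<in> R \<or> (v, u) \<in> R}"
    unfolding nbrs_def by (force simp: doubleton_eq_iff)
qed

text \<open>The complete bipartite graph with parts 2 and 3, plus an isolated vertex. The general
  construction would give only 4 edges at n = 3.\<close>

lemma ex_K23:
  obtains G :: "nat graph" where "balanced_bipartite 3 G" "card (edges G) = 6"
    "graph_free (double_star 2 2) G" "graph_free (spider [2, 2, 1]) G"
proof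
  define A B :: "nat set" where "A = {0, 1, 2}" and "B = {3, 4, 5}"
  define R :: "(nat \<times> nat) set" where "R = {0, 1} \<times> {3, 4, 5}"
  define E where "E = (\<lambda>(a, b). {a, b}) ` R"
  define G where "G = \<lparr>verts = A \<union> B, edges = E\<rparr>"
  have AB: "finite A" "finite B" "A \<inter> B = {}" "R \<subseteq> A \<times> B" "card A = 3" "card B = 3"
    by (auto simp: A_def B_def R_def)
  have "bigraph A B E"
    unfolding E_def by (rule bigraph_of_pairs(1)[OF AB(1-4)])
  then show bal: "balanced_bipartite 3 G"
    by (rule bigraph.balanced_bipartiteI) (use AB in \<open>auto simp: G_def\<close>)
  then have simple: "simple_graph G" by (simp add: balanced_bipartite_def)
  have "card R = 6" by (simp add: R_def card_cartesian_product)
  then show "card (edges G) = 6"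
    unfolding G_def E_def using bigraph_of_pairs(2)[OF AB(1-4)] by simp
  have N: "nbrs (edges G) v = {u. (u, v) \<in> R \<or> (v, u) \<in> R}" for v
    unfolding G_def E_def using bigraph_of_pairs(3)[OF AB(1-4)] by simp
  show "graph_free (double_star 2 2) G"
  proof (rule free_double_star_22I[OF simple])
    fix u v assume "{u, v} \<in> edges G"
    then have "v \<in> nbrs (edges G) u" by (simp add: nbrs_def)
    then have "nbrs (edges G) u \<subseteq> {0, 1} \<or> nbrs (edges G) v \<subseteq> {0, 1}"
      unfolding N by (auto simp: R_def)
    then show "\<exists>S. card S \<le> 2 \<and> finite S \<and> (nbrs (edges G) u \<subseteq> S \<or> nbrs (edges G) v \<subseteq> S)"
      by (intro exI[of _ "{0, 1}"]) auto
  qed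
  show "graph_free (spider [2, 2, 1]) G"
  proof (rule free_spider_221I[OF simple])
    fix c :: nat
    have "nbrs (edges G) c \<subseteq> {0, 1} \<or>
      (\<forall>a \<in> nbrs (edges G) c. nbrs (edges G) a \<subseteq> {0, 1})"
      unfolding N by (auto simp: R_def)
    then show "\<exists>S. card S \<le> 2 \<and> finite S \<and>
      (nbrs (edges G) c \<subseteq> S \<or> (\<forall>a \<in> nbrs (edges G) c. nbrs (edges G) a \<subseteq> S))"
      by (intro exI[of _ "{0, 1}"]) auto
  qed
qed

text \<open>Vertices 0 and 4 joined by three internally disjoint paths of length 3: one high vertex
  on each side, and 3n - 3 edges. Every edge has an interior vertex of a path as an end, and those
  have degree 2.\<close>

lemma ex_9_edges:
  obtains G :: "nat graph" where "balanced_bipartite 4 G" "card (edges G) = 9"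
    "graph_free (double_star 2 2) G"
proof
  define A B :: "nat set" where "A = {0, 1, 2, 3}" and "B = {4, 5, 6, 7}"
  define R :: "(nat \<times> nat) set" where
    "R = {(0, 5), (0, 6), (0, 7), (1, 4), (2, 4), (3, 4), (1, 5), (2, 6), (3, 7)}"
  define E where "E = (\<lambda>(a, b). {a, b}) ` R"
  define G where "G = \<lparr>verts = A \<union> B, edges = E\<rparr>"
  have AB: "finite A" "finite B" "A \<inter> B = {}" "R \<subseteq> A \<times> B" "card A = 4" "card B = 4"
    by (auto simp: A_def B_def R_def)
  have "bigraph A B E"
    unfolding E_def by (rule bigraph_of_pairs(1)[OF AB(1-4)])
  then show bal: "balanced_bipartite 4 G"
    by (rule bigraph.balanced_bipartiteI) (use AB in \<open>auto simp: G_def\<close>)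
  then have simple: "simple_graph G" by (simp add: balanced_bipartite_def)
  have "card R = 9" by (simp add: R_def)
  then show "card (edges G) = 9"
    unfolding G_def E_def using bigraph_of_pairs(2)[OF AB(1-4)] by simp
  have N: "nbrs (edges G) v = {u. (u, v) \<in> R \<or> (v, u) \<in> R}" for v
    unfolding G_def E_def using bigraph_of_pairs(3)[OF AB(1-4)] by simp
  show "graph_free (double_star 2 2) G"
  proof (rule free_double_star_22I[OF simple])
    fix u v assume "{u, v} \<in> edges G"
    then have "v \<in> nbrs (edges G) u" by (simp add: nbrs_def)
    then have "u \<in> {1, 2, 3} \<or> u \<in> {5, 6, 7} \<or> v \<in> {1, 2, 3} \<or> v \<in> {5, 6, 7}"
      unfolding N R_def by auto
    moreover have "nbrs (edges G) w \<subseteq> {4, w + 4}" if "w \<in> {1, 2, 3}" for w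
      using that unfolding N R_def by auto
    moreover have "nbrs (edges G) w \<subseteq> {0, w - 4}" if "w \<in> {5, 6, 7}" for w
      using that unfolding N R_def by auto
    ultimately obtain a b where "nbrs (edges G) u \<subseteq> {a, b} \<or> nbrs (edges G) v \<subseteq> {a, b}"
      by metis
    moreover have "card {a, b} \<le> 2" by (simp add: card_insert_if)
    ultimately show "\<exists>S. card S \<le> 2 \<and> finite S \<and> (nbrs (edges G) u \<subseteq> S \<or> nbrs (edges G) v \<subseteq> S)"
      by (metis finite.emptyI finite_insert)
  qed
qed

section \<open>Vertices of degree at least 3\<close>

definition high :: "'a set set \<Rightarrow> 'a set \<Rightarrow> 'a set" where
  "high E S = {v \<in> S. 3 \<le> deg E v}"

lemma high_subset: "high E S \<subseteq> S"
  by (auto simp: high_def)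

context bigraph
begin

lemma sum_low: "(\<Sum>v\<in>S - high E S. deg E v) \<le> 2 * card (S - high E S)"
proof -
  have "(\<Sum>v\<in>S - high E S. deg E v) \<le> (\<Sum>v\<in>S - high E S. 2)"
    by (rule sum_mono) (auto simp: high_def)
  then show ?thesis by simp
qed

lemma card_low: "S = A \<or> S = B \<Longrightarrow> card (S - high E S) = card S - card (high E S)"
  using finite_A finite_B high_subset finite_subset by (metis card_Diff_subset)

lemma card_edges_split:
  "card E = (\<Sum>a\<in>high E A. deg E a) + (\<Sum>a\<in>A - high E A. deg E a)"
  using card_edges sum.subset_diff[OF high_subset finite_A, of "deg E" E] by simp

lemma card_edges_le_high:
  "card E \<le> (\<Sum>a\<in>high E A. deg E a) + 2 * (card A - card (high E A))"
  using card_edges_split sum_low[of A] card_low[of A] by simp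

lemma card_edges_no_high: "high E A = {} \<Longrightarrow> card E \<le> 2 * card A"
  using card_edges_le_high by simp

lemma card_meeting: "finite S \<Longrightarrow> card {e \<in> E. e \<inter> S \<noteq> {}} \<le> (\<Sum>v\<in>S. deg E v)"
proof -
  assume S: "finite S"
  have "{e \<in> E. e \<inter> S \<noteq> {}} = (\<Union>v\<in>S. {e \<in> E. v \<in> e})" by auto
  then show ?thesis using card_UN_le[OF S, of "\<lambda>v. {e \<in> E. v \<in> e}"] card_incident by simp
qed

text \<open>Each edge outside M is charged to a low end. On the A side the degree sum is kept, not
  replaced by twice the number of low vertices, because leaves among them will have to pay for M
  when M is nonempty.\<close>

lemma card_edges_le_low:
  defines "M \<equiv> {e \<in> E. e \<subseteq> high E A \<union> high E B}"
  shows "card E \<le> (\<Sum>a\<in>A - high E A. deg E a) + 2 * (card B - card (high E B)) + card M"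
proof -
  let ?I = "\<lambda>S. {e \<in> E. e \<inter> S \<noteq> {}}"
  have "E \<subseteq> ?I (A - high E A) \<union> ?I (B - high E B) \<union> M"
    using edge_cases unfolding M_def by fastforce
  then have "card E \<le> card (?I (A - high E A) \<union> ?I (B - high E B) \<union> M)"
    using finite_edges by (intro card_mono) (auto simp: M_def)
  also have "\<dots> \<le> card (?I (A - high E A)) + card (?I (B - high E B)) + card M"
    by (rule order_trans[OF card_Un_le add_right_mono[OF card_Un_le]])
  also have "\<dots> \<le> (\<Sum>a\<in>A - high E A. deg E a) + (\<Sum>b\<in>B - high E B. deg E b) + card M"
    using card_meeting[of "A - high E A"] card_meeting[of "B - high E B"] finite_A finite_B by simp
  finally show ?thesis using sum_low[of B] card_low[of B] by simp
qed

end

section \<open>Double stars with 2 + 2 leaves\<close>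

text \<open>Two ends of degree at least 3 leave two spare neighbours at each; those of u and those
  of v lie on opposite sides and so are distinct.\<close>

lemma (in bigraph) deg_le_2_if_double_star_22_free:
  assumes free: "graph_free (double_star 2 2) G" and G: "simple_graph G" "edges G = E"
    and uv: "{u, v} \<in> E"
  shows "deg E u \<le> 2 \<or> deg E v \<le> 2"
proof (rule ccontr)
  assume deg: "\<not> ?thesis"
  have n: "v \<in> nbrs E u" "u \<in> nbrs E v" using uv by (simp_all add: nbrs_def insert_commute)
  then have "2 \<le> card (nbrs E u - {v})" "2 \<le> card (nbrs E v - {u})"
    using deg finite_nbrs by auto
  then obtain a b c d where *: "a \<in> nbrs E u - {v}" "b \<in> nbrs E u - {v}" "a \<noteq> b"
    "c \<in> nbrs E v - {u}" "d \<in> nbrs E v - {u}" "c \<noteq> d"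
    using card_ge2_obtain by metis
  then have "{a, b, v} \<inter> {c, d, u} = {}"
    using n nbrs_in[of _ u] nbrs_in[of _ v] disjoint by blast
  then have "distinct [u, v, a, b, c, d]" using * by auto
  moreover have "{u, a} \<in> E" "{u, b} \<in> E" "{v, c} \<in> E" "{v, d} \<in> E"
    using * by (simp_all add: nbrs_def)
  ultimately show False
    using free uv unfolding free_double_star_22_iff[OF G(1)] G(2) by blast
qed

text \<open>\<open>low_end\<close> is all that the counting uses about the absence of a double
  star.\<close>

locale sparse_bigraph = bigraph +
  assumes low_end: "{u, v} \<in> E \<Longrightarrow> deg E u \<le> 2 \<or> deg E v \<le> 2"
begin

lemma sparse_swap: "sparse_bigraph B A E"
  using swap low_end by (simp add: sparse_bigraph_def sparse_bigraph_axioms_def)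

lemma nbrs_high: "a \<in> high E A \<Longrightarrow> nbrs E a \<subseteq> B - high E B"
  using low_end nbrs_A[of a] by (fastforce simp: high_def nbrs_def)

lemma deg_high: "a \<in> high E A \<Longrightarrow> deg E a \<le> card B - card (high E B)"
  using card_mono[OF _ nbrs_high] finite_B card_low[of B] by auto

lemma sum_high: "(\<Sum>a\<in>high E A. deg E a) \<le> card (high E A) * (card B - card (high E B))"
  using sum_bounded_above[of "high E A" "deg E"] deg_high by auto

text \<open>Degrees are summed over A: a high vertex sees only low vertices of B, and a low vertex
  has degree at most 2.\<close>

lemma edge_bound1:
  "card E \<le> card (high E A) * (card B - card (high E B)) + 2 * (card A - card (high E A))"
  using card_edges_le_high sum_high by linarith

lemma edge_bound2:
  "card E \<le> 2 * (card A - card (high E A)) + 2 * (card B - card (high E B))"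
proof -
  have M: "{e \<in> E. e \<subseteq> high E A \<union> high E B} = {}"
    using edge_cases low_end by (fastforce simp: high_def)
  show ?thesis
    using card_edges_le_low[unfolded M] sum_low[of A] card_low[of A] by simp
qed

text \<open>The degree sums over high and over low vertices of A are each at most 2(n - 2) and add
  up to 4n - 8. Both are therefore attained, and one deficient vertex would make its sum strictly
  smaller.\<close>

lemma full_of_edges_eq:
  assumes n: "card A = n" "card B = n" and st: "card (high E A) = 2" "card (high E B) = 2"
    and eq: "card E = 4 * n - 8"
  shows "a \<in> high E A \<Longrightarrow> nbrs E a = B - high E B"
    and "a \<in> A - high E A \<Longrightarrow> deg E a = 2"
proof -
  have n2: "2 \<le> n" using st(1) n(1) card_mono[OF finite_A high_subset] by metis
  have fin: "finite (high E A)" using finite_A high_subset finite_subset by metis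
  have S: "(\<Sum>a\<in>high E A. deg E a) = 2 * (n - 2)" "(\<Sum>a\<in>A - high E A. deg E a) = 2 * (n - 2)"
    using eq card_edges_split sum_high sum_low[of A] card_low[of A] n n2 st by simp_all
  show "nbrs E a = B - high E B" if a: "a \<in> high E A"
  proof (rule card_subset_eq)
    show "deg E a = card (B - high E B)"
    proof (rule ccontr)
      assume "deg E a \<noteq> card (B - high E B)"
      then have "deg E a < n - 2" using deg_high[OF a] card_low[of B] n st by simp
      then have "(\<Sum>a\<in>high E A. deg E a) < (\<Sum>a\<in>high E A. n - 2)"
        using fin a deg_high n st by (intro sum_strict_mono_ex1) auto
      then show False using S(1) st by simp
    qed
  qed (use nbrs_high a finite_B in auto)
  show "deg E a = 2" if a: "a \<in> A - high E A"
  proof (rule ccontr)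
    assume "deg E a \<noteq> 2"
    then have "deg E a < 2" using a by (auto simp: high_def)
    then have "(\<Sum>a\<in>A - high E A. deg E a) < (\<Sum>a\<in>A - high E A. 2)"
      using finite_A a by (intro sum_strict_mono_ex1) (auto simp: high_def)
    then show False using S(2) st n card_low[of A] by simp
  qed
qed

end

text \<open>The first two bounds give 2n if s or t is 0, 3n - 3 for (1, 1), 3n - 4 for (1, 2), 3n -
  5 for (1, 3) and their mirror images; the third gives at most 4n - 10 once s + t is at least 5.
  What remains is (2, 2).\<close>

lemma sparse_arith:
  fixes n s t e :: nat
  assumes "e \<le> s * (n - t) + 2 * (n - s)" "e \<le> t * (n - s) + 2 * (n - t)"
    and "e \<le> 2 * (n - s) + 2 * (n - t)" and "3 \<le> n" "s \<le> n" "t \<le> n"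
  shows "e \<le> 2 * n \<or> e \<le> 3 * n - 3 \<and> s = 1 \<and> t = 1 \<or> e \<le> 3 * n - 4 \<or>
    e \<le> 4 * n - 9 \<or> s = 2 \<and> t = 2 \<and> e \<le> 4 * n - 8"
proof -
  have "s = 0 \<or> t = 0 \<or> s = 1 \<and> t = 1 \<or> s = 1 \<and> t = 2 \<or> s = 2 \<and> t = 1 \<or>
    s = 1 \<and> t = 3 \<or> s = 3 \<and> t = 1 \<or> s = 2 \<and> t = 2 \<or> 5 \<le> s + t"
    by presburger
  then show ?thesis
  proof (elim disjE conjE)
    assume "5 \<le> s + t"
    then show ?thesis using assms(3-6) by linarith
  qed (use assms(1-4) in auto)
qed

lemma double_star_22_edge_bound:
  assumes bal: "balanced_bipartite n G" and free: "graph_free (double_star 2 2) G" and n: "3 \<le> n"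
  shows "5 \<le> n \<Longrightarrow> card (edges G) \<le> 4 * n - 8"
    and "n = 3 \<Longrightarrow> card (edges G) \<le> 6"
    and "n = 4 \<Longrightarrow> card (edges G) \<le> 9"
    and "6 \<le> n \<Longrightarrow> card (edges G) = 4 * n - 8 \<Longrightarrow>
      \<exists>A B. sparse_bigraph A B (edges G) \<and> verts G = A \<union> B \<and> card A = n \<and> card B = n \<and>
        card (high (edges G) A) = 2 \<and> card (high (edges G) B) = 2"
proof -
  obtain A B where AB: "bigraph A B (edges G)" "verts G = A \<union> B" "card A = n" "card B = n"
    using balanced_bipartite_bigraph[OF bal] by blast
  have G: "simple_graph G" using bal by (simp add: balanced_bipartite_def)
  have "sparse_bigraph A B (edges G)"
    using AB(1) bigraph.deg_le_2_if_double_star_22_free[OF AB(1) free G]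
    by (simp add: sparse_bigraph_def sparse_bigraph_axioms_def)
  then interpret sparse_bigraph A B "edges G" .
  interpret sym: sparse_bigraph B A "edges G" by (rule sparse_swap)
  have le: "card (high (edges G) A) \<le> n" "card (high (edges G) B) \<le> n"
    using card_mono[OF finite_A high_subset] card_mono[OF finite_B high_subset] AB(3,4) by metis+
  note cases = sparse_arith[OF edge_bound1[unfolded AB(3,4)] sym.edge_bound1[unfolded AB(3,4)]
      edge_bound2[unfolded AB(3,4)] n le]
  show "5 \<le> n \<Longrightarrow> card (edges G) \<le> 4 * n - 8"
    and "n = 3 \<Longrightarrow> card (edges G) \<le> 6"
    and "n = 4 \<Longrightarrow> card (edges G) \<le> 9"
    using cases by auto
  assume "6 \<le> n" "card (edges G) = 4 * n - 8"
  \<comment> \<open>For n at least 6 the values 2n, 3n - 3, 3n - 4 and 4n - 9 all lie below 4n -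
    8.\<close>
  then have "card (high (edges G) A) = 2" "card (high (edges G) B) = 2" using cases by auto
  then show "\<exists>A B. sparse_bigraph A B (edges G) \<and> verts G = A \<union> B \<and> card A = n \<and> card B = n \<and>
        card (high (edges G) A) = 2 \<and> card (high (edges G) B) = 2"
    using AB(2-4) sparse_bigraph_axioms by blast
qed

text \<open>Tightness, applied from both sides, joins each high vertex to all low vertices opposite.
  A low vertex of A thus sees both high vertices of B and, having degree 2, nothing else. So the
  edges are exactly the pairs across with one high end.\<close>

lemma (in sparse_bigraph) K2_components:
  assumes n: "card A = n" "card B = n" and st: "card (high E A) = 2" "card (high E B) = 2"
    and eq: "card E = 4 * n - 8" and G: "verts G = A \<union> B" "edges G = E"
  shows "G \<cong>\<^sub>G copies 2 (complete_bipartite 2 (n - 2))"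
proof -
  interpret sym: sparse_bigraph B A E by (rule sparse_swap)
  note full = full_of_edges_eq[OF n st eq]
  note full' = sym.full_of_edges_eq[OF n(2,1) st(2,1) eq]
  let ?H = "copies 2 (complete_bipartite 2 (n - 2))"
  have sub: "high E A \<subseteq> A" "high E B \<subseteq> B" by (rule high_subset)+
  have fin: "finite (high E A)" "finite (high E B)" "finite (A - high E A)" "finite (B - high E B)"
    using sub finite_A finite_B finite_subset by blast+
  have low: "nbrs E a = high E B" if a: "a \<in> A - high E A" for a
  proof -
    have "b \<in> nbrs E a" if "b \<in> high E B" for b
      using full'(1)[OF that] a nbrs_sym[of b E a] by simp
    then have "high E B \<subseteq> nbrs E a" by blast
    then show ?thesis
      using full(2)[OF a] st(2) finite_nbrs by (metis card_subset_eq)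
  qed
  have adj: "{a, b} \<in> E \<longleftrightarrow> (a \<in> high E A \<longleftrightarrow> b \<notin> high E B)" if "a \<in> A" "b \<in> B" for a b
  proof -
    have "{a, b} \<in> E \<longleftrightarrow> b \<in> nbrs E a" by (simp add: nbrs_def)
    then show ?thesis using full(1)[of a] low[of a] that by blast
  qed
  obtain h where h: "bij_betw h (high E A) {..<2 :: nat}"
    using ex_bij_betw_finite_nat[OF fin(1)] st(1) by (auto simp: atLeast0LessThan)
  obtain h' where h': "bij_betw h' (high E B) {..<2 :: nat}"
    using ex_bij_betw_finite_nat[OF fin(2)] st(2) by (auto simp: atLeast0LessThan)
  obtain l where l: "bij_betw l (A - high E A) {..<n - 2}"
    using ex_bij_betw_finite_nat[OF fin(3)] card_low[of A] st(1) n by (auto simp: atLeast0LessThan)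
  obtain l' where l': "bij_betw l' (B - high E B) {..<n - 2}"
    using ex_bij_betw_finite_nat[OF fin(4)] card_low[of B] st(2) n by (auto simp: atLeast0LessThan)
  \<comment> \<open>Copy 0 holds the high vertices of A and the low ones of B, copy 1 the high
    vertices of B and the low ones of A; \<open>Inl\<close> numbers the high pair in both.\<close>
  define f where "f v = (if v \<in> high E A then (0 :: nat, Inl (h v) :: nat + nat)
    else if v \<in> high E B then (1, Inl (h' v)) else if v \<in> B then (0, Inr (l' v)) else (1, Inr (l v)))" for v
  have f: "\<And>v. v \<in> high E A \<Longrightarrow> f v = (0, Inl (h v))" "\<And>v. v \<in> high E B \<Longrightarrow> f v = (1, Inl (h' v))"
    "\<And>v. v \<in> B - high E B \<Longrightarrow> f v = (0, Inr (l' v))" "\<And>v. v \<in> A - high E A \<Longrightarrow> f v = (1, Inr (l v))"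
    using sub disjoint by (auto simp: f_def)
  have split: "A \<union> B = (high E A \<union> (B - high E B)) \<union> (high E B \<union> (A - high E A))"
    using sub by blast
  have bij: "bij_betw (\<lambda>v. (i, Inl (g v))) S ({i} \<times> Inl ` {..<m})"
    "bij_betw (\<lambda>v. (i, Inr (g v))) S ({i} \<times> Inr ` {..<m})"
    if "bij_betw g S {..<m}" for i m :: nat and g and S :: "'a set"
    using that unfolding bij_betw_def by (auto simp: inj_on_def image_iff)
  have parts: "bij_betw f (high E A) ({0} \<times> Inl ` {..<2})"
    "bij_betw f (high E B) ({1} \<times> Inl ` {..<2})"
    "bij_betw f (B - high E B) ({0} \<times> Inr ` {..<n - 2})"
    "bij_betw f (A - high E A) ({1} \<times> Inr ` {..<n - 2})"
  proof -
    show "bij_betw f (high E A) ({0} \<times> Inl ` {..<2})"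
      using bij_betw_cong[THEN iffD2, OF f(1) bij(1)[OF h, of 0]] .
    show "bij_betw f (high E B) ({1} \<times> Inl ` {..<2})"
      using bij_betw_cong[THEN iffD2, OF f(2) bij(1)[OF h', of 1]] .
    show "bij_betw f (B - high E B) ({0} \<times> Inr ` {..<n - 2})"
      using bij_betw_cong[THEN iffD2, OF f(3) bij(2)[OF l', of 0]] .
    show "bij_betw f (A - high E A) ({1} \<times> Inr ` {..<n - 2})"
      using bij_betw_cong[THEN iffD2, OF f(4) bij(2)[OF l, of 1]] .
  qed
  have verts: "verts ?H = ({0} \<times> Inl ` {..<2} \<union> {0} \<times> Inr ` {..<n - 2}) \<union>
      ({1} \<times> Inl ` {..<2} \<union> {1} \<times> Inr ` {..<n - 2})"
    unfolding verts_copies_complete by (auto simp: less_2_cases_iff)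
  have "bij_betw f (A \<union> B) (verts ?H)"
    unfolding split verts
    by (intro bij_betw_combine parts) auto
  moreover have "edges ?H = (`) f ` E"
  proof (intro equalityI subsetI)
    fix e assume "e \<in> (`) f ` E"
    then obtain a b where ab: "a \<in> A" "b \<in> B" "{a, b} \<in> E" "e = {f a, f b}"
      using edge_cases by force
    then consider "a \<in> high E A" "b \<in> B - high E B" | "a \<in> A - high E A" "b \<in> high E B"
      using adj by blast
    then obtain i p q where "e = {(i, Inl p), (i, Inr q)}" "i < 2" "p < 2" "q < n - 2"
    proof cases
      case 1
      then have "h a < 2" "l' b < n - 2" using bij_betw_apply[OF h] bij_betw_apply[OF l'] by simp_all
      then show thesis using that[of 0 "h a" "l' b"] ab(4) f 1 by simp
    next
      case 2
      then have "h' b < 2" "l a < n - 2" using bij_betw_apply[OF h'] bij_betw_apply[OF l] by simp_all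
      then show thesis using that[of 1 "h' b" "l a"] ab(4) f 2 by (simp add: insert_commute)
    qed
    then show "e \<in> edges ?H" unfolding edges_copies_complete by blast
  next
    fix e assume "e \<in> edges ?H"
    then obtain i p q where e: "e = {(i, Inl p), (i, Inr q)}" "i < 2" "p < 2" "q < n - 2"
      by (auto simp: edges_copies_complete)
    consider "i = 0" | "i = 1" using e(2) by linarith
    then have "\<exists>a \<in> A. \<exists>b \<in> B. {a, b} \<in> E \<and> e = {f a, f b}"
    proof cases
      case 1
      obtain a where "a \<in> high E A" "h a = p"
        using h e(3) by (metis bij_betw_imp_surj_on imageE lessThan_iff)
      moreover obtain b where "b \<in> B - high E B" "l' b = q"
        using l' e(4) by (metis bij_betw_imp_surj_on imageE lessThan_iff)
      ultimately have "a \<in> A" "b \<in> B" "{a, b} \<in> E" "e = {f a, f b}"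
        using sub adj e(1) f 1 by auto
      then show ?thesis by blast
    next
      case 2
      obtain b where "b \<in> high E B" "h' b = p"
        using h' e(3) by (metis bij_betw_imp_surj_on imageE lessThan_iff)
      moreover obtain a where "a \<in> A - high E A" "l a = q"
        using l e(4) by (metis bij_betw_imp_surj_on imageE lessThan_iff)
      ultimately have "a \<in> A" "b \<in> B" "{a, b} \<in> E" "e = {f a, f b}"
        using sub adj e(1) f 2 by (auto simp: insert_commute)
      then show ?thesis by blast
    qed
    then obtain a b where "{a, b} \<in> E" "e = f ` {a, b}" by auto
    then show "e \<in> (`) f ` E" by blast
  qed
  ultimately show ?thesis
    using G unfolding graph_iso_def by metis
qed

section \<open>Spiders with legs 2, 2, 1\<close>

text \<open>Freeness in the form in which it is applied: given a third neighbour of the centre, two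
  legs of length 2 must end in the same vertex. The remaining coincidences are ruled out by the
  premises or by the sides.\<close>

locale S221_free_bigraph = bigraph +
  assumes no_S221: "\<lbrakk>a \<in> nbrs E c; b \<in> nbrs E a; a' \<in> nbrs E c; b' \<in> nbrs E a'; x \<in> nbrs E c;
    a \<noteq> a'; a \<noteq> x; a' \<noteq> x; b \<noteq> c; b' \<noteq> c\<rbrakk> \<Longrightarrow> b = b'"
begin

lemma S221_free_swap: "S221_free_bigraph B A E"
proof -
  have "S221_free_bigraph_axioms E" by unfold_locales (rule no_S221)
  then show ?thesis using swap by (simp add: S221_free_bigraph_def)
qed

text \<open>A second neighbour b' of w would give the legs v, w, b' and v, u, b and a third
  neighbour x of v. Degree 3 is just enough: b must avoid v and b', and x must avoid u and
  w.\<close>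

lemma leaf_of_high_edge:
  assumes "u \<in> nbrs E v" "3 \<le> deg E u" "3 \<le> deg E v" "w \<in> nbrs E v" "w \<noteq> u"
  shows "deg E w \<le> 1"
proof (rule ccontr)
  assume "\<not> deg E w \<le> 1"
  then have "1 \<le> card (nbrs E w - {v})"
    using assms(4) nbrs_sym[of w E v] by (simp add: finite_nbrs)
  then obtain b' where b': "b' \<in> nbrs E w" "b' \<noteq> v" using card_ge1_obtain by blast
  have "deg E u - card {v, b'} \<le> card (nbrs E u - {v, b'})"
    "deg E v - card {u, w} \<le> card (nbrs E v - {u, w})"
    by (rule diff_card_le_card_Diff; simp)+
  then have "1 \<le> card (nbrs E u - {v, b'})" "1 \<le> card (nbrs E v - {u, w})"
    using assms(2,3,5) b' by auto
  then obtain b x where "b \<in> nbrs E u - {v, b'}" "x \<in> nbrs E v - {u, w}"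
    using card_ge1_obtain by metis
  then show False using no_S221[of u v b w b' x] assms(1,4,5) b' by auto
qed

text \<open>Of three non-leaf neighbours, any two start long legs and the third is the short leg, so
  their further neighbours coincide. That common vertex lies in A and has degree at least 3,
  although u is the only such vertex.\<close>

lemma few_nonleaf_nbrs:
  assumes u: "u \<in> A" "high E A = {u}"
  shows "card {b \<in> nbrs E u. 2 \<le> deg E b} \<le> 2"
proof (rule ccontr)
  let ?S = "{b \<in> nbrs E u. 2 \<le> deg E b}"
  assume "\<not> card ?S \<le> 2"
  then have "3 \<le> card ?S" by simp
  then obtain T where "T \<subseteq> ?S" "card T = 3" by (meson obtain_subset_with_card_n)
  then obtain x1 x2 x3 where x: "x1 \<in> ?S" "x2 \<in> ?S" "x3 \<in> ?S" "x1 \<noteq> x2" "x1 \<noteq> x3" "x2 \<noteq> x3"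
    by (auto simp: card_3_iff)
  have "\<exists>w. w \<in> nbrs E x \<and> w \<noteq> u" if "x \<in> ?S" for x
  proof -
    have "u \<in> nbrs E x" using \<open>x \<in> ?S\<close> nbrs_sym[of x E u] by simp
    then have "1 \<le> card (nbrs E x - {u})" using \<open>x \<in> ?S\<close> finite_nbrs by auto
    then show ?thesis using card_ge1_obtain by blast
  qed
  then obtain w1 w2 w3 where w: "w1 \<in> nbrs E x1" "w2 \<in> nbrs E x2" "w3 \<in> nbrs E x3"
    "w1 \<noteq> u" "w2 \<noteq> u" "w3 \<noteq> u"
    using x by metis
  have "w1 = w2" using no_S221[of x1 u w1 x2 w2 x3] x w by simp
  moreover have "w1 = w3" using no_S221[of x1 u w1 x3 w3 x2] x w by simp
  ultimately have "{x1, x2, x3} \<subseteq> nbrs E w1" using w nbrs_sym by (metis empty_subsetI insert_subset)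
  then have "card {x1, x2, x3} \<le> deg E w1" using finite_nbrs card_mono by metis
  then have "3 \<le> deg E w1" using x by simp
  moreover have "w1 \<in> A"
    using w(1) x(1) u(1) nbrs_A[of u] nbrs_B[of x1] by blast
  ultimately show False using u(2) w(4) by (auto simp: high_def)
qed

text \<open>At least deg u - 2 neighbours of u are leaves, and each lowers the count over B by 1: e
  is at most deg v + 2(|B| - 1) - (deg u - 2). Added to the mirrored inequality, the degrees cancel,
  which leaves e at most 2n when s = t = 1.\<close>

lemma card_edges_add_deg_le:
  assumes "high E A = {u}" "high E B = {v}"
  shows "card E + deg E u \<le> deg E v + 2 * card B"
proof -
  have u: "u \<in> A" "3 \<le> deg E u" and v: "v \<in> B" "3 \<le> deg E v"
    using assms by (auto simp: high_def)
  let ?X = "{b \<in> nbrs E u. deg E b \<le> 1}" and ?S = "{b \<in> nbrs E u. 2 \<le> deg E b}"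
  have "deg E u = card ?X + card ?S"
    using finite_nbrs by (subst card_Un_disjoint[symmetric]) (auto intro: arg_cong[of _ _ card])
  then have X: "deg E u \<le> card ?X + 2" using few_nonleaf_nbrs u(1) assms(1) by simp
  have sub: "?X \<subseteq> B - {v}" using nbrs_A[OF u(1)] v by auto
  have fin: "finite ?X" "finite (B - {v})" using finite_nbrs finite_B by auto
  have "(\<Sum>b\<in>B - {v}. deg E b) = (\<Sum>b\<in>B - {v} - ?X. deg E b) + (\<Sum>b\<in>?X. deg E b)"
    by (rule sum.subset_diff[OF sub fin(2)])
  also have "\<dots> \<le> (\<Sum>b\<in>B - {v} - ?X. 2) + (\<Sum>b\<in>?X. 1)"
  proof (intro add_mono sum_mono)
    fix b assume "b \<in> B - {v} - ?X"
    then have "b \<in> B - high E B" using assms(2) by simp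
    then show "deg E b \<le> 2" by (auto simp: high_def)
  qed simp
  also have "\<dots> = 2 * (card B - 1 - card ?X) + card ?X"
    using sub fin finite_B v(1) by (simp add: card_Diff_subset)
  finally have "card E \<le> deg E v + (2 * (card B - 1 - card ?X) + card ?X)"
    using card_edges' sum.remove[OF finite_B v(1), of "deg E"] by simp
  moreover have "card ?X \<le> card B - 1" using card_mono[OF fin(2) sub] v(1) finite_B by simp
  moreover have "1 \<le> card B" using v(1) finite_B by (metis One_nat_def Suc_leI card_gt_0_iff empty_iff)
  ultimately show ?thesis using X by linarith
qed

text \<open>An edge {u, v} of M is sent to a neighbour of v other than u, which is a leaf in A. The
  leaf determines v, its only neighbour, and v determines u, since any further neighbour of v would
  be a leaf. Leaves count 1 instead of 2 in the degree sum, and this saving covers M.\<close>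

lemma edge_bound_low:
  "card E \<le> 2 * (card A - card (high E A)) + 2 * (card B - card (high E B))"
proof -
  define M where "M = {e \<in> E. e \<subseteq> high E A \<union> high E B}"
  define L where "L = {a \<in> A - high E A. deg E a \<le> 1}"
  have ends: "\<exists>u v. e = {u, v} \<and> u \<in> high E A \<and> v \<in> high E B \<and> u \<in> nbrs E v \<and> v \<in> nbrs E u"
    if "e \<in> M" for e
  proof -
    obtain u v where "u \<in> A" "v \<in> B" "e = {u, v}"
      using \<open>e \<in> M\<close> edge_cases[of e] by (auto simp: M_def)
    moreover from this have "u \<in> high E A" "v \<in> high E B"
      using that disjoint high_subset[of E A] high_subset[of E B] by (auto simp: M_def)
    moreover have "{u, v} \<in> E" using that calculation(3) by (simp add: M_def)
    ultimately show ?thesis by (auto simp: nbrs_def insert_commute)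
  qed
  have "\<exists>x. x \<in> L \<and> (\<exists>u v. e = {u, v} \<and> u \<in> high E A \<and> v \<in> high E B \<and> u \<in> nbrs E v \<and> x \<in> nbrs E v)"
    if e: "e \<in> M" for e
  proof -
    obtain u v where uv: "e = {u, v}" "u \<in> high E A" "v \<in> high E B" "u \<in> nbrs E v"
      using ends[OF e] by blast
    have "1 \<le> card (nbrs E v - {u})" using uv finite_nbrs by (auto simp: high_def)
    then obtain x where x: "x \<in> nbrs E v" "x \<noteq> u" using card_ge1_obtain by blast
    then have "deg E x \<le> 1" using leaf_of_high_edge[of u v x] uv by (auto simp: high_def)
    moreover have "x \<in> A" using x(1) uv(3) nbrs_B[of v] high_subset[of E B] by blast
    ultimately have "x \<in> L" by (auto simp: L_def high_def)
    then show ?thesis using uv x by blast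
  qed
  then obtain g where g: "\<And>e. e \<in> M \<Longrightarrow> g e \<in> L"
    "\<And>e. e \<in> M \<Longrightarrow> \<exists>u v. e = {u, v} \<and> u \<in> high E A \<and> v \<in> high E B \<and> u \<in> nbrs E v \<and> g e \<in> nbrs E v"
    by metis
  have "inj_on g M"
  proof (rule inj_onI)
    fix e e' assume e: "e \<in> M" "e' \<in> M" "g e = g e'"
    obtain u v where uv: "e = {u, v}" "u \<in> high E A" "v \<in> high E B" "u \<in> nbrs E v" "g e \<in> nbrs E v"
      using g(2)[OF e(1)] by blast
    obtain u' v' where uv': "e' = {u', v'}" "u' \<in> high E A" "v' \<in> high E B" "u' \<in> nbrs E v'"
      "g e \<in> nbrs E v'"
      using g(2)[OF e(2)] e(3) by auto
    have "v \<in> nbrs E (g e)" "v' \<in> nbrs E (g e)" using uv(5) uv'(5) nbrs_sym by metis+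
    moreover have "deg E (g e) \<le> 1" using g(1)[OF e(1)] by (simp add: L_def)
    ultimately have "v = v'" using finite_nbrs card_le_Suc0_iff_eq[of "nbrs E (g e)"] by auto
    moreover have "u = u'"
    proof (rule ccontr)
      assume "u \<noteq> u'"
      then have "deg E u' \<le> 1"
        using leaf_of_high_edge[of u v u'] uv uv' \<open>v = v'\<close> by (auto simp: high_def)
      then show False using uv'(2) by (simp add: high_def)
    qed
    ultimately show "e = e'" using uv(1) uv'(1) by simp
  qed
  moreover have finL: "finite L" using finite_A by (simp add: L_def)
  ultimately have "card M \<le> card L" using g(1) by (meson card_inj_on_le image_subsetI)
  have L: "L \<subseteq> A - high E A" by (auto simp: L_def)
  have "(\<Sum>a\<in>A - high E A. deg E a) = (\<Sum>a\<in>A - high E A - L. deg E a) + (\<Sum>a\<in>L. deg E a)"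
    using finite_A by (intro sum.subset_diff[OF L]) simp
  also have "\<dots> \<le> (\<Sum>a\<in>A - high E A - L. 2) + (\<Sum>a\<in>L. 1)"
    by (intro add_mono sum_mono) (auto simp: high_def L_def)
  also have "\<dots> + card L = 2 * (card A - card (high E A))"
    using card_low[of A] card_mono[OF _ L] L finL finite_A by (simp add: card_Diff_subset)
  finally show ?thesis
    using card_edges_le_low \<open>card M \<le> card L\<close> unfolding M_def by linarith
qed

text \<open>Compared with |A| + 2(|B| - 1), two units must be saved. If v misses both high vertices
  of A, its degree is at most |A| - 2. Otherwise it meets only one, as the other would be a leaf;
  this saves one unit, and a leaf x next to the high vertex it meets saves the second.\<close>

lemma card_edges_high_2_1:
  assumes "card (high E A) = 2" "card (high E B) = 1"
  shows "card E + 4 \<le> card A + 2 * card B"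
proof -
  obtain u u' where A: "high E A = {u, u'}" "u \<noteq> u'" using assms(1) by (auto simp: card_2_iff)
  obtain v where B: "high E B = {v}" using assms(2) by (auto simp: card_1_singleton_iff)
  have u: "u \<in> A" "u' \<in> A" "3 \<le> deg E u" "3 \<le> deg E u'" and v: "v \<in> B" "3 \<le> deg E v"
    using A B by (auto simp: high_def)
  have A2: "card (A - {u, u'}) = card A - 2" "2 \<le> card A"
    using u A(2) card_mono[OF finite_A, of "{u, u'}"] by (auto simp: card_Diff_subset)
  have cardB: "card (B - {v}) = card B - 1" "1 \<le> card B"
    using v(1) finite_B by (auto simp: Suc_le_eq card_gt_0_iff)
  have low: "deg E b \<le> 2" if "b \<in> B - {v}" for b
  proof -
    have "b \<in> B - high E B" using that B by simp
    then show ?thesis by (auto simp: high_def)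
  qed
  have E: "card E = deg E v + (\<Sum>b\<in>B - {v}. deg E b)"
    using card_edges' sum.remove[OF finite_B v(1)] by simp
  show ?thesis
  proof (cases "\<exists>w \<in> {u, u'}. w \<in> nbrs E v")
    case False
    then have "nbrs E v \<subseteq> A - {u, u'}" using nbrs_B[OF v(1)] by blast
    then have "deg E v \<le> card A - 2" using A2 card_mono finite_A by (metis finite_Diff)
    moreover have "(\<Sum>b\<in>B - {v}. deg E b) \<le> 2 * (card B - 1)"
      using sum_bounded_above[of "B - {v}" "deg E" 2] low cardB by simp
    ultimately show ?thesis using E A2(2) cardB(2) by linarith
  next
    case True
    then obtain w w' where w: "w \<in> nbrs E v" "{w, w'} = {u, u'}" "w \<noteq> w'" using A(2) by blast
    then have deg_w: "3 \<le> deg E w" "3 \<le> deg E w'" "w \<in> A" "w' \<in> A"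
      using u by (auto simp: doubleton_eq_iff)
    then have "w' \<notin> nbrs E v" using leaf_of_high_edge[of w v w'] w v by auto
    then have "nbrs E v \<subseteq> A - {w'}" using nbrs_B[OF v(1)] by blast
    then have "deg E v \<le> card (A - {w'})" using card_mono finite_A by (metis finite_Diff)
    then have "deg E v \<le> card A - 1" using deg_w(4) by simp
    have "1 \<le> card (nbrs E w - {v})"
      using deg_w(1) finite_nbrs[of w] by (auto simp: card_Diff_singleton_if)
    then obtain x where x: "x \<in> nbrs E w" "x \<noteq> v" using card_ge1_obtain by blast
    then have "deg E x \<le> 1" "x \<in> B - {v}"
      using leaf_of_high_edge[of v w x] w(1) nbrs_sym[of w E v] deg_w v nbrs_A[of w] by auto
    have "(\<Sum>b\<in>B - {v}. deg E b) = deg E x + (\<Sum>b\<in>B - {v} - {x}. deg E b)"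
      using finite_B \<open>x \<in> B - {v}\<close> by (intro sum.remove) auto
    also have "(\<Sum>b\<in>B - {v} - {x}. deg E b) \<le> 2 * card (B - {v} - {x})"
      using sum_bounded_above[of "B - {v} - {x}" "deg E" 2] low by simp
    also have "card (B - {v} - {x}) = card B - 2" using \<open>x \<in> B - {v}\<close> cardB by simp
    finally have "(\<Sum>b\<in>B - {v}. deg E b) \<le> deg E x + 2 * (card B - 2)" by simp
    moreover have "2 \<le> card B"
      using \<open>x \<in> B - {v}\<close> v(1) card_mono[OF finite_B, of "{x, v}"] by auto
    ultimately show ?thesis
      using E \<open>deg E v \<le> card A - 1\<close> \<open>deg E x \<le> 1\<close> A2(2) by linarith
  qed
qed

end

text \<open>Once s + t is at least 4, the general bound is 4n - 8; below that, with both sides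
  having high vertices, only (1, 1), (2, 1) and (1, 2) remain. The value 4n - 8 dominates from n = 4
  on, while at n = 3 the largest is 2n = 6.\<close>

lemma spider_221_edge_bound:
  assumes bal: "balanced_bipartite n G" and free: "graph_free (spider [2, 2, 1]) G" and n: "3 \<le> n"
  shows "card (edges G) \<le> 2 * n \<or> card (edges G) \<le> 3 * n - 4 \<or> card (edges G) \<le> 4 * n - 8"
proof -
  obtain A B where AB: "bigraph A B (edges G)" "verts G = A \<union> B" "card A = n" "card B = n"
    using balanced_bipartite_bigraph[OF bal] by blast
  have G: "simple_graph G" using bal by (simp add: balanced_bipartite_def)
  interpret bigraph A B "edges G" by fact
  have "b = b'" if "a \<in> nbrs (edges G) c" "b \<in> nbrs (edges G) a" "a' \<in> nbrs (edges G) c"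
    "b' \<in> nbrs (edges G) a'" "x \<in> nbrs (edges G) c" "a \<noteq> a'" "a \<noteq> x" "a' \<noteq> x" "b \<noteq> c" "b' \<noteq> c"
    for c a b a' b' x
  proof (rule ccontr)
    assume "b \<noteq> b'"
    have "{a, a', x} \<inter> {c, b, b'} = {}"
      using that(1-5)[THEN nbrs_in] disjoint by auto
    then have "distinct [c, a, b, a', b', x]" using that(6-) \<open>b \<noteq> b'\<close> by auto
    moreover have "{c, a} \<in> edges G" "{a, b} \<in> edges G" "{c, a'} \<in> edges G" "{a', b'} \<in> edges G"
      "{c, x} \<in> edges G"
      using that(1-5) by (simp_all add: nbrs_def)
    ultimately show False using free unfolding free_spider_221_iff[OF G] by metis
  qed
  then interpret S221_free_bigraph A B "edges G" by unfold_locales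
  interpret sym: S221_free_bigraph B A "edges G" by (rule S221_free_swap)
  let ?s = "card (high (edges G) A)" and ?t = "card (high (edges G) B)"
  have fin: "finite (high (edges G) A)" "finite (high (edges G) B)"
    using finite_A finite_B high_subset finite_subset by metis+
  have le: "?s \<le> n" "?t \<le> n"
    using card_mono[OF finite_A high_subset] card_mono[OF finite_B high_subset] AB(3,4) by metis+
  have "?s = 0 \<or> ?t = 0 \<or> ?s = 1 \<and> ?t = 1 \<or> ?s = 2 \<and> ?t = 1 \<or> ?s = 1 \<and> ?t = 2 \<or> 4 \<le> ?s + ?t"
    by presburger
  then show ?thesis
  proof (elim disjE conjE)
    assume "?s = 0"
    then show ?thesis using card_edges_no_high fin AB(3) by simp
  next
    assume "?t = 0"
    then show ?thesis using sym.card_edges_no_high fin AB(4) by simp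
  next
    assume "?s = 1" "?t = 1"
    then obtain u v where "high (edges G) A = {u}" "high (edges G) B = {v}"
      by (auto simp: card_1_singleton_iff)
    then show ?thesis
      using card_edges_add_deg_le[of u v] sym.card_edges_add_deg_le[of v u] AB(3,4) by simp
  next
    assume "?s = 2" "?t = 1"
    then show ?thesis using card_edges_high_2_1[unfolded AB(3,4)] by linarith
  next
    assume "?s = 1" "?t = 2"
    then show ?thesis using sym.card_edges_high_2_1[unfolded AB(3,4)] by linarith
  next
    assume "4 \<le> ?s + ?t"
    then show ?thesis using edge_bound_low[unfolded AB(3,4)] le n by linarith
  qed
qed

section \<open>The extremal numbers\<close>

lemma spider_311_edge_bound:
  assumes bal: "balanced_bipartite n G" and free: "graph_free (spider [3, 1, 1]) G"
  shows "card (edges G) \<le> 3 * n"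
    and "card (edges G) = 3 * n \<Longrightarrow> \<exists>k. n = 3 * k \<and> G \<cong>\<^sub>G copies k (complete_bipartite 3 3)"
proof -
  obtain A B where AB: "bigraph A B (edges G)" "verts G = A \<union> B" "card A = n" "card B = n"
    using balanced_bipartite_bigraph[OF bal] by blast
  interpret bigraph A B "edges G" by fact
  have free': "\<not> has_S311 (edges G)"
    using free bal free_spider_311_iff_has_S311 by (auto simp: balanced_bipartite_def)
  show "card (edges G) \<le> 3 * n" using S311_edge_bound(1)[OF AB(1) free'] AB(3,4) by simp
  assume "card (edges G) = 3 * n"
  then have "deg (edges G) v = 3" if "v \<in> A \<union> B" for v
    using S311_edge_bound(2)[OF AB(1) free' _ that] AB(3,4) by simp
  then show "\<exists>k. n = 3 * k \<and> G \<cong>\<^sub>G copies k (complete_bipartite 3 3)"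
    using K33_components[OF free' _ AB(2)] AB(3) by simp
qed

text \<open>Both claims are read off from a graph attaining the maximum: if it has 3n edges, it is a
  union of blocks with three vertices per side, so 3 divides n. For the converse the blocks
  themselves are the witness.\<close>

lemma ex_b_spider_311_le: "ex_b n (spider [3, 1, 1]) \<le> 3 * n"
  and ex_b_spider_311_eq_iff: "ex_b n (spider [3, 1, 1]) = 3 * n \<longleftrightarrow> 3 dvd n"
proof -
  have "edges (spider [3, 1, 1]) \<noteq> {}" by (subst spider_311) simp
  then obtain G :: "nat graph" where G: "extremal_b n (spider [3, 1, 1]) G"
    using ex_b_attained simple_forbidden(1) by metis
  then show "ex_b n (spider [3, 1, 1]) \<le> 3 * n"
    using spider_311_edge_bound(1) by (metis extremal_b_def)
  show "ex_b n (spider [3, 1, 1]) = 3 * n \<longleftrightarrow> 3 dvd n"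
  proof
    assume "ex_b n (spider [3, 1, 1]) = 3 * n"
    then show "3 dvd n"
      using G spider_311_edge_bound(2) unfolding extremal_b_def by (metis dvd_triv_left)
  next
    assume "3 dvd n"
    then obtain k where n: "n = 3 * k" by (rule dvdE)
    show "ex_b n (spider [3, 1, 1]) = 3 * n"
    proof (rule ex_b_eqI)
      show "balanced_bipartite n (copies k (complete_bipartite 3 3))"
        unfolding n by (rule balanced_copies_K33)
      show "card (edges (copies k (complete_bipartite 3 3))) = 3 * n"
        unfolding n by (simp add: card_edges_copies_complete)
    qed (use simple_forbidden(1) free_copies_K33 spider_311_edge_bound(1) in blast)+
  qed
qed

lemma ex_b_double_star_22:
  "5 \<le> n \<Longrightarrow> ex_b n (double_star 2 2) = 4 * n - 8"
  "ex_b 3 (double_star 2 2) = 6"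
  "ex_b 4 (double_star 2 2) = 9"
proof -
  show "ex_b n (double_star 2 2) = 4 * n - 8" if "5 \<le> n"
    using that copies_K2[of n]
    by (intro ex_b_eqI[OF simple_forbidden(3)] double_star_22_edge_bound(1)) auto
  obtain G3 :: "nat graph" where G3: "balanced_bipartite 3 G3" "card (edges G3) = 6"
    "graph_free (double_star 2 2) G3" by (rule ex_K23)
  show "ex_b 3 (double_star 2 2) = 6"
    by (rule ex_b_eqI[OF simple_forbidden(3) G3(1,3,2)])
      (use double_star_22_edge_bound(2) in auto)
  obtain G4 :: "nat graph" where G4: "balanced_bipartite 4 G4" "card (edges G4) = 9"
    "graph_free (double_star 2 2) G4" by (rule ex_9_edges)
  show "ex_b 4 (double_star 2 2) = 9"
    by (rule ex_b_eqI[OF simple_forbidden(3) G4(1,3,2)])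
      (use double_star_22_edge_bound(3) in auto)
qed

lemma ex_b_spider_221:
  "4 \<le> n \<Longrightarrow> ex_b n (spider [2, 2, 1]) = 4 * n - 8"
  "ex_b 3 (spider [2, 2, 1]) = 6"
proof -
  show "ex_b n (spider [2, 2, 1]) = 4 * n - 8" if n: "4 \<le> n"
  proof (rule ex_b_eqI[OF simple_forbidden(2)])
    show "card (edges G) \<le> 4 * n - 8"
      if "balanced_bipartite n G" "graph_free (spider [2, 2, 1]) G" for G :: "nat graph"
      using spider_221_edge_bound[OF that] n by linarith
  qed (use copies_K2[of n] n in auto)
  obtain G :: "nat graph" where G: "balanced_bipartite 3 G" "card (edges G) = 6"
    "graph_free (spider [2, 2, 1]) G" by (rule ex_K23)
  show "ex_b 3 (spider [2, 2, 1]) = 6"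
  proof (rule ex_b_eqI[OF simple_forbidden(2) G(1,3,2)])
    show "card (edges G) \<le> 6"
      if "balanced_bipartite 3 G" "graph_free (spider [2, 2, 1]) G" for G :: "nat graph"
      using spider_221_edge_bound[OF that] by linarith
  qed
qed

theorem theorem6:
  shows
    "(\<forall>n \<ge> 4.
        ex_b n (spider [3, 1, 1]) \<le> 3 * n
        \<and> (ex_b n (spider [3, 1, 1]) = 3 * n \<longleftrightarrow> 3 dvd n)
        \<and> (3 dvd n \<longrightarrow>
             extremal_b n (spider [3, 1, 1]) (copies (n div 3) (complete_bipartite 3 3))
             \<and> (\<forall>G :: 'a graph. extremal_b n (spider [3, 1, 1]) G \<longrightarrow>
                  G \<cong>\<^sub>G copies (n div 3) (complete_bipartite 3 3))))
     \<and>
     ((\<forall>n \<ge> 5. ex_b n (double_star 2 2) = 4 * n - 8)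
        \<and> (\<forall>n \<ge> 6.
             extremal_b n (double_star 2 2) (copies 2 (complete_bipartite 2 (n - 2)))
             \<and> (\<forall>G :: 'a graph. extremal_b n (double_star 2 2) G \<longrightarrow>
                  G \<cong>\<^sub>G copies 2 (complete_bipartite 2 (n - 2))))
        \<and> ex_b 3 (double_star 2 2) = 6
        \<and> ex_b 4 (double_star 2 2) = 9)
     \<and>
     ((\<forall>n \<ge> 4. ex_b n (spider [2, 2, 1]) = 4 * n - 8)
        \<and> ex_b 3 (spider [2, 2, 1]) = 6)"
proof -
  have "extremal_b n (spider [3, 1, 1]) (copies (n div 3) (complete_bipartite 3 3))"
    if "3 dvd n" for n
  proof -
    obtain k where n: "n = 3 * k" using \<open>3 dvd n\<close> by (rule dvdE)
    then show ?thesis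
      using balanced_copies_K33[of k] free_copies_K33[of k] ex_b_spider_311_eq_iff[of n]
      by (simp add: extremal_b_def card_edges_copies_complete)
  qed
  moreover have "G \<cong>\<^sub>G copies (n div 3) (complete_bipartite 3 3)"
    if n: "3 dvd n" and G: "extremal_b n (spider [3, 1, 1]) G" for n and G :: "'a graph"
  proof -
    have "card (edges G) = 3 * n" using n G ex_b_spider_311_eq_iff by (metis extremal_b_def)
    then obtain k where "n = 3 * k" "G \<cong>\<^sub>G copies k (complete_bipartite 3 3)"
      using spider_311_edge_bound(2) G unfolding extremal_b_def by metis
    then show ?thesis by simp
  qed
  moreover have "extremal_b n (double_star 2 2) (copies 2 (complete_bipartite 2 (n - 2)))"
    if "6 \<le> n" for n
    using that copies_K2[of n] ex_b_double_star_22(1)[of n] by (simp add: extremal_b_def)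
  moreover have "G \<cong>\<^sub>G copies 2 (complete_bipartite 2 (n - 2))"
    if n: "6 \<le> n" and G: "extremal_b n (double_star 2 2) G" for n and G :: "'a graph"
  proof -
    have E: "card (edges G) = 4 * n - 8"
      using n G ex_b_double_star_22(1)[of n] by (simp add: extremal_b_def)
    obtain A B where "sparse_bigraph A B (edges G)" "verts G = A \<union> B" "card A = n" "card B = n"
      "card (high (edges G) A) = 2" "card (high (edges G) B) = 2"
      using double_star_22_edge_bound(4)[of n G] G n E by (auto simp: extremal_b_def)
    then show ?thesis using sparse_bigraph.K2_components E by blast
  qed
  ultimately show ?thesis
    using ex_b_spider_311_le ex_b_spider_311_eq_iff ex_b_double_star_22 ex_b_spider_221 by simp
qed

end
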